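(* For every nonnegative integer $k$, the limit $\ell(k) := \lim_{n\to\infty} P_{n,M}(k)$ exists, where $P_{n,M}(k) := P(2n-1-|S-S| = k)$ for $S$ a uniformly random subset of $[n]=\{0,\dots,n-1\}$. Moreover $\ell(k) > 0$ if and only if $k$ is even, $\sum_{k=0}^\infty \ell(k) = 1$, and \[ \ell(10) < \ell(8) < \ell(0) < \ell(6) < \ell(2) < \ell(4). \]
   Context: For a positive integer $n$, $[n] := \{0,1,\dots,n-1\}$, and $S$ is chosen uniformly at random among all $2^n$ subsets of $[n]$. The difference set is $S-S := \{x-y : x,y \in S\}$. *)

theory Defs
  imports "HOL-Probability.Probability"
begin

definition diff_set :: "int set \<Rightarrow> int set" where
  "diff_set S = {x - y | x y. x \<in> S \<and> y \<in> S}"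

definition P_missing :: "nat \<Rightarrow> nat \<Rightarrow> real" where
  "P_missing n k =
     measure_pmf.prob (pmf_of_set (Pow {0..<int n}))
       {S. 2 * int n - 1 - int (card (diff_set S)) = int k}"

text \<open>The value of \<^const>\<open>lim\<close> is meaningful only for a convergent sequence; convergence has to be
  stated separately.\<close>

definition ell :: "nat \<Rightarrow> real" where
  "ell k = lim (\<lambda>n. P_missing n k)"

end

theory Submission
  imports Defs
begin

text \<open>
  Encode S as a bit list xs of length n. The difference n - 1 - t is missing from S - S iff t is not
  in X + Y, where X and Y are the supports of xs and rev xs. Differences n - 1 - t with large t are
  missing only with exponentially small probability, and for small t only the two ends of S matter,
  which are independent. So ell (2 * k) is the probability that X + Y misses exactly k naturals, for
  independent uniformly random sets X and Y of naturals.

  If 0 is not in X, deleting it shifts X + Y by one. Hence, with Q k the distribution conditioned on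
  0 lying in both X and Y, one has Q k = 4 ell (2k) - 4 ell (2k - 2) + ell (2k - 4), and each of the
  five inequalities becomes a linear inequality in the Q k with a workable margin. Those are
  established by exploring the tree of common prefixes of X and Y. At a leaf the probability that j
  is missed is a product of simple factors, so the expected number of further misses is explicit;
  this bounds the conditional expectation of the linear functional in question.
\<close>

section \<open>Averages over bit lists\<close>

text \<open>Let L(z) be the generating function of \<open>ell (2 * k)\<close> and Q(z) that of Q k.
  Conditioning on 0 in one of the two sets multiplies by 2 - z, so Q(z) = (2 - z)^2 L(z), and
  \<open>ell (2 * k)\<close> is the sum over i \<le> k of (k - i + 1) Q i / 2^(k - i + 2). Clearing
  denominators in the difference of two such sums yields the integer coefficients of the five final
  inequalities. The obstacle to deciding them by a finite computation is that every node of the tree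
  has infinitely many undecided positions ahead. A second obstacle concerns the existence of the
  limits: \<open>xs\<close> and \<open>rev xs\<close> are dependent, so misses far from the ends
  cannot be treated as for independent sets. There only half of the relevant pairs of bits are used,
  chosen disjoint, and this turns the decay rate 3 / 4 into its square root.\<close>

definition blists :: "nat \<Rightarrow> bool list set" where
  "blists n = {xs. length xs = n}"

definition bit_at :: "bool list \<Rightarrow> nat \<Rightarrow> bool" where
  "bit_at xs i \<longleftrightarrow> i < length xs \<and> xs ! i"

definition hit :: "bool list \<Rightarrow> bool list \<Rightarrow> nat \<Rightarrow> bool" where
  "hit xs ys j \<longleftrightarrow> (\<exists>i\<le>j. bit_at xs i \<and> bit_at ys (j - i))"

definition misses :: "nat \<Rightarrow> bool list \<Rightarrow> bool list \<Rightarrow> nat" where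
  "misses m xs ys = card {j. j < m \<and> \<not> hit xs ys j}"

text \<open>Positions beyond the end of a list are treated as independent fair coins, so \<open>miss_prob xs ys j\<close>
  is the probability that j is not hit by a random continuation of \<open>xs\<close> and \<open>ys\<close>.\<close>

definition prob_at :: "bool list \<Rightarrow> nat \<Rightarrow> real" where
  "prob_at xs i = (if i < length xs then of_bool (xs ! i) else 1 / 2)"

definition miss_prob :: "bool list \<Rightarrow> bool list \<Rightarrow> nat \<Rightarrow> real" where
  "miss_prob xs ys j = (\<Prod>i\<le>j. 1 - prob_at xs i * prob_at ys (j - i))"

text \<open>Finite averages stand in for a probability space of infinite sequences: the expectation
  of \<open>g\<close> after d further fair coins on each side.\<close>

definition ext_avg :: "nat \<Rightarrow> (bool list \<Rightarrow> bool list \<Rightarrow> real) \<Rightarrow> bool list \<Rightarrow> bool list \<Rightarrow> real" where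
  "ext_avg d g xs ys = (\<Sum>us\<in>blists d. \<Sum>vs\<in>blists d. g (xs @ us) (ys @ vs)) / 4 ^ d"

lemma blists_0 [simp]: "blists 0 = {[]}"
  by (auto simp: blists_def)

lemma finite_blists [simp]: "finite (blists n)"
  and card_blists [simp]: "card (blists n) = 2 ^ n"
  using finite_lists_length_eq[of "UNIV :: bool set" n] card_lists_length_eq[of "UNIV :: bool set" n]
  by (simp_all add: blists_def)

lemma length_blists: "xs \<in> blists n \<Longrightarrow> length xs = n"
  by (simp add: blists_def)

lemma sum_blists_Suc:
  fixes g :: "bool list \<Rightarrow> 'a::comm_monoid_add"
  shows "sum g (blists (Suc n)) = (\<Sum>xs\<in>blists n. g (True # xs)) + (\<Sum>xs\<in>blists n. g (False # xs))"
proof -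
  have "blists (Suc n) = (#) True ` blists n \<union> (#) False ` blists n"
  proof (rule set_eqI)
    fix xs :: "bool list"
    show "xs \<in> blists (Suc n) \<longleftrightarrow> xs \<in> (#) True ` blists n \<union> (#) False ` blists n"
      by (cases xs) (auto simp: blists_def image_iff)
  qed
  moreover have "((#) True ` blists n) \<inter> ((#) False ` blists n) = {}"
    by auto
  ultimately show ?thesis
    by (simp add: sum.union_disjoint sum.reindex)
qed

lemma sum_blists_Suc_snoc:
  fixes g :: "bool list \<Rightarrow> 'a::comm_monoid_add"
  shows "sum g (blists (Suc n)) = (\<Sum>xs\<in>blists n. g (xs @ [True])) + (\<Sum>xs\<in>blists n. g (xs @ [False]))"
proof -
  have "blists (Suc n) = (\<lambda>xs. xs @ [True]) ` blists n \<union> (\<lambda>xs. xs @ [False]) ` blists n"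
  proof (rule set_eqI)
    fix xs :: "bool list"
    show "xs \<in> blists (Suc n) \<longleftrightarrow>
        xs \<in> (\<lambda>xs. xs @ [True]) ` blists n \<union> (\<lambda>xs. xs @ [False]) ` blists n"
      by (cases xs rule: rev_cases) (auto simp: blists_def image_iff)
  qed
  moreover have "((\<lambda>xs. xs @ [True]) ` blists n) \<inter> ((\<lambda>xs. xs @ [False]) ` blists n) = {}"
    by auto
  ultimately show ?thesis
    by (simp add: sum.union_disjoint sum.reindex inj_on_def)
qed

lemma ext_avg_0 [simp]: "ext_avg 0 g xs ys = g xs ys"
  by (simp add: ext_avg_def)

lemma ext_avg_Suc:
  "ext_avg (Suc d) g xs ys =
    (ext_avg d g (xs @ [True]) (ys @ [True]) + ext_avg d g (xs @ [True]) (ys @ [False]) +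
     ext_avg d g (xs @ [False]) (ys @ [True]) + ext_avg d g (xs @ [False]) (ys @ [False])) / 4"
  by (simp add: ext_avg_def sum_blists_Suc sum.distrib add_divide_distrib)

lemma ext_avg_mono:
  assumes "\<And>us vs. us \<in> blists d \<Longrightarrow> vs \<in> blists d \<Longrightarrow> g (xs @ us) (ys @ vs) \<le> h (xs @ us) (ys @ vs)"
  shows "ext_avg d g xs ys \<le> ext_avg d h xs ys"
  unfolding ext_avg_def by (intro divide_right_mono sum_mono assms) auto

lemma ext_avg_cong:
  assumes "\<And>us vs. us \<in> blists d \<Longrightarrow> vs \<in> blists d \<Longrightarrow> g (xs @ us) (ys @ vs) = h (xs @ us) (ys @ vs)"
  shows "ext_avg d g xs ys = ext_avg d h xs ys"
  by (intro antisym ext_avg_mono) (simp_all add: assms)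

lemma ext_avg_const [simp]: "ext_avg d (\<lambda>_ _. c) xs ys = c"
proof -
  have "(2::real) ^ d * 2 ^ d = 4 ^ d"
    by (simp flip: power_mult_distrib)
  then have "(2::real) ^ d * (2 ^ d * c) / 4 ^ d = c"
    by (simp add: mult.assoc[symmetric])
  then show ?thesis by (simp add: ext_avg_def)
qed

lemma ext_avg_add: "ext_avg d (\<lambda>as bs. g as bs + h as bs) xs ys = ext_avg d g xs ys + ext_avg d h xs ys"
  by (simp add: ext_avg_def sum.distrib add_divide_distrib)

lemma ext_avg_cmult: "ext_avg d (\<lambda>as bs. c * g as bs) xs ys = c * ext_avg d g xs ys"
  by (simp add: ext_avg_def sum_distrib_left)

lemma ext_avg_sum: "ext_avg d (\<lambda>as bs. \<Sum>i\<in>I. g i as bs) xs ys = (\<Sum>i\<in>I. ext_avg d (g i) xs ys)"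
  by (induction I rule: infinite_finite_induct) (simp_all add: ext_avg_add)

lemma miss_prob_commute: "miss_prob xs ys j = miss_prob ys xs j"
proof -
  have "miss_prob xs ys j = (\<Prod>i\<le>j. 1 - prob_at xs (j - i) * prob_at ys (j - (j - i)))"
    unfolding miss_prob_def atMost_atLeast0 by (subst prod.atLeastAtMost_rev) simp
  also have "\<dots> = miss_prob ys xs j"
    unfolding miss_prob_def by (intro prod.cong) (auto simp: mult.commute)
  finally show ?thesis .
qed

text \<open>\<open>miss_prob\<close> is affine in each unknown bit, which makes it a martingale along the prefix tree.\<close>

lemma miss_prob_snoc: "miss_prob xs ys j = (miss_prob (xs @ [True]) ys j + miss_prob (xs @ [False]) ys j) / 2"
proof (cases "length xs \<le> j")
  case True
  have *: "miss_prob zs ys j = (1 - prob_at zs (length xs) * prob_at ys (j - length xs)) *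
      (\<Prod>i\<in>{..j} - {length xs}. 1 - prob_at zs i * prob_at ys (j - i))" for zs
    unfolding miss_prob_def using True by (subst prod.remove[of _ "length xs"]) auto
  have "(\<Prod>i\<in>{..j} - {length xs}. 1 - prob_at (xs @ [b]) i * prob_at ys (j - i)) =
      (\<Prod>i\<in>{..j} - {length xs}. 1 - prob_at xs i * prob_at ys (j - i))" for b
    by (intro prod.cong) (auto simp: prob_at_def nth_append)
  then show ?thesis
    unfolding * by (simp add: prob_at_def field_simps)
next
  case False
  then have "miss_prob (xs @ [b]) ys j = miss_prob xs ys j" for b
    unfolding miss_prob_def by (intro prod.cong) (auto simp: prob_at_def nth_append)
  then show ?thesis by simp
qed

text \<open>Once the continuation covers position j, \<open>miss_prob\<close> is an indicator by
  \<open>miss_prob_known\<close>, so this identifies the product with a true probability.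
  Independence enters only through the fact that, for fixed j, each unknown bit occurs in a single
  factor.\<close>

lemma ext_avg_miss_prob: "ext_avg d (\<lambda>as bs. miss_prob as bs j) xs ys = miss_prob xs ys j"
proof (induction d arbitrary: xs ys)
  case (Suc d)
  have "miss_prob xs ys j = (miss_prob (xs @ [True]) (ys @ [True]) j + miss_prob (xs @ [True]) (ys @ [False]) j +
     miss_prob (xs @ [False]) (ys @ [True]) j + miss_prob (xs @ [False]) (ys @ [False]) j) / 4"
    using miss_prob_snoc[of xs ys j] miss_prob_snoc[of ys "xs @ [True]" j]
      miss_prob_snoc[of ys "xs @ [False]" j] by (simp add: miss_prob_commute[of ys "xs @ [True]"] miss_prob_commute[of ys "xs @ [False]"]
        miss_prob_commute[of "ys @ [True]" "xs @ [True]"] miss_prob_commute[of "ys @ [True]" "xs @ [False]"]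
        miss_prob_commute[of "ys @ [False]" "xs @ [True]"] miss_prob_commute[of "ys @ [False]" "xs @ [False]"])
  with Suc show ?case by (simp add: ext_avg_Suc)
qed simp

lemma miss_prob_known:
  assumes "j < length xs" "j < length ys"
  shows "miss_prob xs ys j = of_bool (\<not> hit xs ys j)"
proof (cases "hit xs ys j")
  case True
  then obtain i where "i \<le> j" "bit_at xs i" "bit_at ys (j - i)" by (auto simp: hit_def)
  then show ?thesis using True
    by (auto simp: miss_prob_def prob_at_def bit_at_def intro!: prod_zero bexI[of _ i])
next
  case False
  with assms have "\<And>i. i \<le> j \<Longrightarrow> 1 - prob_at xs i * prob_at ys (j - i) = 1"
    by (auto simp: hit_def prob_at_def bit_at_def)
  then have "miss_prob xs ys j = (\<Prod>i\<le>j. 1)"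
    unfolding miss_prob_def by (intro prod.cong) auto
  with False show ?thesis by simp
qed

lemma miss_prob_nonneg: "miss_prob xs ys j \<ge> 0"
  unfolding miss_prob_def
  by (intro prod_nonneg) (auto simp: prob_at_def)

lemma hit_append:
  assumes "j < length xs" "j < length ys"
  shows "hit (xs @ us) (ys @ vs) j = hit xs ys j"
  using assms by (auto simp: hit_def bit_at_def nth_append)

lemma misses_append:
  assumes "m \<le> length xs" "m \<le> length ys"
  shows "misses m (xs @ us) (ys @ vs) = misses m xs ys"
  unfolding misses_def using assms by (intro arg_cong[of _ _ card]) (auto simp: hit_append)

lemma misses_split:
  "misses (m + d) xs ys = misses m xs ys + card {j. m \<le> j \<and> j < m + d \<and> \<not> hit xs ys j}"
proof -
  have "{j. j < m + d \<and> \<not> hit xs ys j} = {j. j < m \<and> \<not> hit xs ys j} \<union> {j. m \<le> j \<and> j < m + d \<and> \<not> hit xs ys j}"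
    by auto
  moreover have "{j. j < m \<and> \<not> hit xs ys j} \<inter> {j. m \<le> j \<and> j < m + d \<and> \<not> hit xs ys j} = {}"
    by auto
  moreover have "finite {j. m \<le> j \<and> j < m + d \<and> \<not> hit xs ys j}"
    by (rule finite_subset[of _ "{..<m + d}"]) auto
  ultimately show ?thesis
    unfolding misses_def by (simp add: card_Un_disjoint)
qed

lemma hit_commute: "hit xs ys j = hit ys xs j"
proof -
  have "hit ys xs j" if h: "hit xs ys j" for xs ys
  proof -
    from h obtain i where i: "i \<le> j" "bit_at xs i" "bit_at ys (j - i)" by (auto simp: hit_def)
    then show ?thesis unfolding hit_def by (intro exI[of _ "j - i"]) simp
  qed
  then show ?thesis by blast
qed

section \<open>Expected number of further misses\<close>

text \<open>Linearity of expectation: after d further bits all positions below m + d are decided,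
  and their indicators equal \<open>miss_prob\<close>.\<close>

lemma ext_avg_late_misses:
  assumes "length xs = m" "length ys = m"
  shows "ext_avg d (\<lambda>as bs. real (card {j. m \<le> j \<and> j < m + d \<and> \<not> hit as bs j})) xs ys =
    (\<Sum>j\<in>{m..<m + d}. miss_prob xs ys j)"
proof -
  have "real (card {j. m \<le> j \<and> j < m + d \<and> \<not> hit (xs @ us) (ys @ vs) j}) =
      (\<Sum>j\<in>{m..<m + d}. miss_prob (xs @ us) (ys @ vs) j)"
    if "us \<in> blists d" "vs \<in> blists d" for us vs
  proof -
    have "{j. m \<le> j \<and> j < m + d \<and> \<not> hit (xs @ us) (ys @ vs) j} =
        {m..<m + d} \<inter> {j. \<not> hit (xs @ us) (ys @ vs) j}"
      by auto
    then have "real (card {j. m \<le> j \<and> j < m + d \<and> \<not> hit (xs @ us) (ys @ vs) j}) =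
        (\<Sum>j\<in>{m..<m + d}. of_bool (\<not> hit (xs @ us) (ys @ vs) j))"
      by simp
    also have "\<dots> = (\<Sum>j\<in>{m..<m + d}. miss_prob (xs @ us) (ys @ vs) j)"
      using that assms by (intro sum.cong) (auto simp: miss_prob_known length_blists)
    finally show ?thesis .
  qed
  then have "ext_avg d (\<lambda>as bs. real (card {j. m \<le> j \<and> j < m + d \<and> \<not> hit as bs j})) xs ys =
      ext_avg d (\<lambda>as bs. \<Sum>j\<in>{m..<m + d}. miss_prob as bs j) xs ys"
    by (intro ext_avg_cong)
  then show ?thesis
    by (simp add: ext_avg_sum ext_avg_miss_prob)
qed

lemma ext_avg_linear_bound:
  assumes len: "length xs = m" "length ys = m"
    and f: "\<And>t. f (misses m xs ys + t) \<le> \<alpha> + \<beta> * real t"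
  shows "ext_avg d (\<lambda>as bs. f (misses (m + d) as bs)) xs ys \<le>
    \<alpha> + \<beta> * (\<Sum>j\<in>{m..<m + d}. miss_prob xs ys j)"
proof -
  have "ext_avg d (\<lambda>as bs. f (misses (m + d) as bs)) xs ys \<le>
      ext_avg d (\<lambda>as bs. \<alpha> + \<beta> * real (card {j. m \<le> j \<and> j < m + d \<and> \<not> hit as bs j})) xs ys"
    using len by (intro ext_avg_mono) (simp add: misses_split misses_append f)
  then show ?thesis
    by (simp add: ext_avg_add ext_avg_cmult ext_avg_late_misses[OF len])
qed

text \<open>If nothing more is missed, then in particular j is hit, which has probability 1 -
  \<open>miss_prob xs ys j\<close>. The bound is best for the j most likely to be missed.\<close>

lemma ext_avg_first_miss_bound:
  assumes len: "length xs = m" "length ys = m"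
    and f: "\<And>t. f (misses m xs ys + t) \<le> \<alpha> + \<gamma> * of_bool (t = 0)"
    and "\<gamma> \<ge> 0" and j: "m \<le> j" "j < m + d"
  shows "ext_avg d (\<lambda>as bs. f (misses (m + d) as bs)) xs ys \<le> \<alpha> + \<gamma> * (1 - miss_prob xs ys j)"
proof -
  have "f (misses (m + d) (xs @ us) (ys @ vs)) \<le> \<alpha> + \<gamma> + (- \<gamma>) * miss_prob (xs @ us) (ys @ vs) j"
    if "us \<in> blists d" "vs \<in> blists d" for us vs
  proof -
    let ?L = "{j. m \<le> j \<and> j < m + d \<and> \<not> hit (xs @ us) (ys @ vs) j}"
    have "f (misses (m + d) (xs @ us) (ys @ vs)) \<le> \<alpha> + \<gamma> * of_bool (card ?L = 0)"
      using len by (simp only: misses_split misses_append f order_refl)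
    also have "card ?L = 0 \<longleftrightarrow> ?L = {}"
      by simp
    also have "\<gamma> * of_bool (?L = {}) \<le> \<gamma> * (1 - of_bool (\<not> hit (xs @ us) (ys @ vs) j))"
      using j \<open>\<gamma> \<ge> 0\<close> by (intro mult_left_mono) auto
    also have "of_bool (\<not> hit (xs @ us) (ys @ vs) j) = miss_prob (xs @ us) (ys @ vs) j"
      using len that j by (intro miss_prob_known[symmetric]) (auto simp: length_blists)
    finally show ?thesis by (simp add: algebra_simps)
  qed
  then have "ext_avg d (\<lambda>as bs. f (misses (m + d) as bs)) xs ys \<le>
      ext_avg d (\<lambda>as bs. \<alpha> + \<gamma> + (- \<gamma>) * miss_prob as bs j) xs ys"
    by (intro ext_avg_mono)
  also have "\<dots> = \<alpha> + \<gamma> * (1 - miss_prob xs ys j)"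
    by (simp only: ext_avg_add ext_avg_cmult ext_avg_const ext_avg_miss_prob) (simp add: algebra_simps)
  finally show ?thesis .
qed

section \<open>Closed form of the miss probability after prefixes of equal length\<close>

definition half_if :: "bool \<Rightarrow> real" where
  "half_if b = (if b then 1 / 2 else 1)"

definition prefix_weight :: "bool list \<Rightarrow> nat \<Rightarrow> real" where
  "prefix_weight xs i = (\<Prod>l<i. half_if (xs ! l))"

lemma half_if_pos: "half_if b > 0"
  by (simp add: half_if_def)

lemma prefix_weight_nonneg: "prefix_weight xs i \<ge> 0"
  by (simp add: prefix_weight_def prod_nonneg half_if_pos less_imp_le)

text \<open>In the pair l, m + i - l, an index l \<le> i faces an unknown bit of \<open>ys\<close>,
  and an index l \<ge> m is unknown and faces a known bit of \<open>ys\<close>. In between both bits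
  are known and give no hit. A known True facing a coin contributes 1 / 2, a known False contributes
  1.\<close>

lemma miss_prob_near:
  assumes len: "length xs = m" "length ys = m" and "i < m" and nh: "\<not> hit xs ys (m + i)"
  shows "miss_prob xs ys (m + i) = prefix_weight xs (Suc i) * prefix_weight ys (Suc i)"
proof -
  let ?F = "\<lambda>l. 1 - prob_at xs l * prob_at ys (m + i - l)"
  have split: "{..m + i} = {..<Suc i} \<union> ({Suc i..<m} \<union> {m..m + i})"
    using \<open>i < m\<close> by auto
  have "prod ?F {..<Suc i} = prefix_weight xs (Suc i)"
    unfolding prefix_weight_def using assms by (intro prod.cong) (auto simp: prob_at_def half_if_def)
  moreover have "prod ?F {Suc i..<m} = 1"
  proof (intro prod.neutral ballI)
    fix l assume l: "l \<in> {Suc i..<m}"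
    then have "\<not> (bit_at xs l \<and> bit_at ys (m + i - l))"
      using nh unfolding hit_def by auto
    then show "?F l = 1"
      using l len by (auto simp: prob_at_def bit_at_def)
  qed
  moreover have "prod ?F {m..m + i} = prefix_weight ys (Suc i)"
    unfolding prefix_weight_def
    by (rule prod.reindex_bij_witness[of _ "\<lambda>l. m + i - l" "\<lambda>l. m + i - l"])
      (use assms in \<open>auto simp: prob_at_def half_if_def\<close>)
  moreover have "prod ?F {..m + i} = prod ?F {..<Suc i} * (prod ?F {Suc i..<m} * prod ?F {m..m + i})"
    unfolding split by (subst prod.union_disjoint; (subst prod.union_disjoint)?) (use \<open>i < m\<close> in auto)
  ultimately show ?thesis
    by (simp add: miss_prob_def)
qed

lemma miss_prob_hit:
  assumes "hit xs ys j"
  shows "miss_prob xs ys j = 0"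
proof -
  from assms obtain i where "i \<le> j" "bit_at xs i" "bit_at ys (j - i)" by (auto simp: hit_def)
  then show ?thesis
    by (auto simp: miss_prob_def prob_at_def bit_at_def intro!: prod_zero bexI[of _ i])
qed

text \<open>From position 2m on, no pair consists of two known bits; exactly \<open>Suc i\<close>
  pairs consist of two coins and avoid a hit with probability 3 / 4 each.\<close>

lemma miss_prob_far:
  assumes len: "length xs = m" "length ys = m"
  shows "miss_prob xs ys (2 * m + i) = prefix_weight xs m * prefix_weight ys m * (3 / 4) ^ Suc i"
proof -
  let ?F = "\<lambda>l. 1 - prob_at xs l * prob_at ys (2 * m + i - l)"
  have split: "{..2 * m + i} = {..<m} \<union> ({m..m + i} \<union> {m + i<..2 * m + i})"
    by auto
  have "prod ?F {..<m} = prefix_weight xs m"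
    unfolding prefix_weight_def using assms by (intro prod.cong) (auto simp: prob_at_def half_if_def)
  moreover have "prod ?F {m..m + i} = (\<Prod>l\<in>{m..m + i}. 3 / 4)"
    using assms by (intro prod.cong) (auto simp: prob_at_def)
  moreover have "prod ?F {m + i<..2 * m + i} = prefix_weight ys m"
    unfolding prefix_weight_def
    by (rule prod.reindex_bij_witness[of _ "\<lambda>l. 2 * m + i - l" "\<lambda>l. 2 * m + i - l"])
      (use assms in \<open>auto simp: prob_at_def half_if_def\<close>)
  moreover have "prod ?F {..2 * m + i} = prod ?F {..<m} * (prod ?F {m..m + i} * prod ?F {m + i<..2 * m + i})"
    unfolding split by (subst prod.union_disjoint; (subst prod.union_disjoint)?) auto
  ultimately show ?thesis
    by (simp add: miss_prob_def)
qed

text \<open>Horner form of the sum in \<open>tail_weight_eq_sum\<close>: \<open>hs\<close> flags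
  which of the positions m, ..., 2m - 1 are already hit, and 3 is the geometric series of (3 / 4)^(i
  + 1) over i \<ge> 0.\<close>

primrec tail_weight :: "bool list \<Rightarrow> bool list \<Rightarrow> bool list \<Rightarrow> real" where
  "tail_weight [] xs ys = 3"
| "tail_weight (h # hs) xs ys =
    half_if (hd xs) * half_if (hd ys) * (of_bool (\<not> h) + tail_weight hs (tl xs) (tl ys))"

lemma prefix_weight_Cons: "prefix_weight (x # xs) (Suc i) = half_if x * prefix_weight xs i"
  unfolding prefix_weight_def by (subst prod.lessThan_Suc_shift) simp

lemma tail_weight_eq_sum:
  assumes "length xs = length hs" "length ys = length hs"
  shows "tail_weight hs xs ys =
    (\<Sum>i<length hs. of_bool (\<not> hs ! i) * (prefix_weight xs (Suc i) * prefix_weight ys (Suc i))) +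
    3 * (prefix_weight xs (length hs) * prefix_weight ys (length hs))"
  using assms
proof (induction hs arbitrary: xs ys)
  case Nil
  then show ?case by (simp add: prefix_weight_def)
next
  case (Cons h hs)
  then obtain x xs' y ys' where xy: "xs = x # xs'" "ys = y # ys'"
    by (metis length_Suc_conv)
  have "(\<Sum>i<length (h # hs). of_bool (\<not> (h # hs) ! i) * (prefix_weight xs (Suc i) * prefix_weight ys (Suc i))) =
      of_bool (\<not> h) * (half_if x * half_if y) + (\<Sum>i<length hs. half_if x * half_if y *
        (of_bool (\<not> hs ! i) * (prefix_weight xs' (Suc i) * prefix_weight ys' (Suc i))))"
    unfolding xy prefix_weight_Cons length_Cons
    by (subst sum.lessThan_Suc_shift) (simp add: prefix_weight_def[of _ 0] algebra_simps)
  then show ?case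
    using Cons.IH[of xs' ys'] Cons.prems unfolding xy
    by (simp add: prefix_weight_Cons sum_distrib_left[symmetric] algebra_simps)
qed

lemma sum_miss_prob_le_tail_weight:
  assumes len: "length xs = m" "length ys = m" "length hs = m"
    and hs: "\<And>i. i < m \<Longrightarrow> hs ! i \<longleftrightarrow> hit xs ys (m + i)"
  shows "(\<Sum>j\<in>{m..<m + d}. miss_prob xs ys j) \<le> tail_weight hs xs ys"
proof -
  let ?w = "prefix_weight xs m * prefix_weight ys m"
  \<comment> \<open>Adding m nonnegative terms makes the range contain all of m, ..., 2m - 1 even
    for small d.\<close>
  have "(\<Sum>j\<in>{m..<m + d}. miss_prob xs ys j) \<le> (\<Sum>j\<in>{m..<2 * m + d}. miss_prob xs ys j)"
    by (intro sum_mono2) (auto simp: miss_prob_nonneg)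
  also have "{m..<2 * m + d} = {m..<m + m} \<union> {2 * m..<2 * m + d}"
    by auto
  also have "(\<Sum>j\<in>\<dots>. miss_prob xs ys j) =
      (\<Sum>j\<in>{m..<m + m}. miss_prob xs ys j) + (\<Sum>j\<in>{2 * m..<2 * m + d}. miss_prob xs ys j)"
    by (intro sum.union_disjoint) auto
  also have "(\<Sum>j\<in>{m..<m + m}. miss_prob xs ys j) = (\<Sum>i<m. miss_prob xs ys (m + i))"
    by (rule sum.reindex_bij_witness[of _ "\<lambda>i. m + i" "\<lambda>j. j - m"]) auto
  also have "\<dots> = (\<Sum>i<m. of_bool (\<not> hs ! i) * (prefix_weight xs (Suc i) * prefix_weight ys (Suc i)))"
    using len hs by (intro sum.cong) (auto simp: miss_prob_near miss_prob_hit)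
  also have "(\<Sum>j\<in>{2 * m..<2 * m + d}. miss_prob xs ys j) = (\<Sum>i<d. miss_prob xs ys (2 * m + i))"
    by (rule sum.reindex_bij_witness[of _ "\<lambda>i. 2 * m + i" "\<lambda>j. j - 2 * m"]) auto
  also have "\<dots> = ?w * (3 / 4) * (\<Sum>i<d. (3 / 4) ^ i)"
    unfolding sum_distrib_left using len by (intro sum.cong) (simp_all add: miss_prob_far)
  also have "\<dots> \<le> ?w * (3 / 4) * 4"
  proof (intro mult_left_mono)
    show "(\<Sum>i<d. (3 / 4 :: real) ^ i) \<le> 4"
      by (subst geometric_sum) (auto simp: field_simps)
  qed (simp add: prefix_weight_nonneg)
  finally show ?thesis
    using len by (simp add: tail_weight_eq_sum)
qed

section \<open>Bounds by exploring the prefix tree\<close>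

text \<open>All quantities are scaled by the mass \<open>s\<close> of the node and rounded up, so that only additions
  of \<open>num\<close> occur. An odd number is not halved at all, which is a valid, coarser upper bound.\<close>

fun halve :: "bool \<Rightarrow> num \<Rightarrow> num" where
  "halve False n = n"
| "halve True (num.Bit0 n) = n"
| "halve True n = n"

fun tail_bound :: "bool list \<Rightarrow> bool list \<Rightarrow> bool list \<Rightarrow> num \<Rightarrow> num" where
  "tail_bound (True # hs) (a # as) (b # bs) n = tail_bound hs as bs (halve a (halve b n))"
| "tail_bound (False # hs) (a # as) (b # bs) n =
    halve a (halve b n) + tail_bound hs as bs (halve a (halve b n))"
| "tail_bound [] _ _ n = n + num.Bit0 n"

text \<open>The Horner step n (1 - p / 2) = n / 2 + (n / 2) (1 - p), with \<open>k\<close> bounding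
  the last product.\<close>

fun add_half :: "bool \<Rightarrow> num \<Rightarrow> num \<Rightarrow> num" where
  "add_half True n k = halve True n + k"
| "add_half False n k = k"

text \<open>Bounds n (1 - p) for the chance p of missing the first position not known to be hit. At
  that position the exact remainder is 0; \<open>num\<close> has no zero, so \<open>num.One\<close>
  replaces it. If all listed positions are hit, p is taken as 0.\<close>

fun no_miss_bound :: "bool list \<Rightarrow> bool list \<Rightarrow> bool list \<Rightarrow> num \<Rightarrow> num" where
  "no_miss_bound (True # hs) (a # as) (b # bs) n =
    add_half a n (add_half b (halve a n) (no_miss_bound hs as bs (halve b (halve a n))))"
| "no_miss_bound (False # hs) (a # as) (b # bs) n = add_half a n (add_half b (halve a n) num.One)"
| "no_miss_bound [] _ _ n = n"

text \<open>How to bound f at a node with k misses, where t counts the misses still to come: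
  \<open>Const _ \<alpha>\<close> stands for f (k + t) \<open>\<le> \<alpha>\<close>, \<open>Linear _ \<alpha> \<beta>\<close> for f (k + t) \<open>\<le> \<alpha> + \<beta>\<close> t, and
  \<open>Unless_Miss _ \<alpha> \<gamma>\<close> for f (k + t) \<open>\<le> \<alpha>\<close> if t > 0 and \<open>\<le> \<alpha> + \<gamma>\<close> if t = 0. The first argument is the
  cutoff below which a node is not split any further.\<close>

datatype leaf_rule = Const num num | Linear num num num | Unless_Miss num num num

fun cutoff :: "leaf_rule \<Rightarrow> num" where
  "cutoff (Const t _) = t"
| "cutoff (Linear t _ _) = t"
| "cutoff (Unless_Miss t _ _) = t"

fun leaf_bound :: "leaf_rule \<Rightarrow> num \<Rightarrow> num \<Rightarrow> bool list \<Rightarrow> bool list \<Rightarrow> bool list \<Rightarrow> num" where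
  "leaf_bound (Const _ \<alpha>) s t hs xs ys = s * \<alpha>"
| "leaf_bound (Linear _ \<alpha> \<beta>) s t hs xs ys = s * \<alpha> + t * \<beta>"
| "leaf_bound (Unless_Miss _ \<alpha> \<gamma>) s t hs xs ys = s * \<alpha> + no_miss_bound hs xs ys s * \<gamma>"

text \<open>A new True at index m of one list hits m + i for every i in the other set, so the flags
  from m on change by a pointwise disjunction with the other list.\<close>

fun or_list :: "bool list \<Rightarrow> bool list \<Rightarrow> bool list" where
  "or_list (h # hs) (True # xs) = True # or_list hs xs"
| "or_list (h # hs) (False # xs) = h # or_list hs xs"
| "or_list hs _ = hs"

text \<open>An evaluator receives the rules for the current and all larger numbers of misses, the mass of
  the node, the known hits at positions m, ..., 2m - 1, and the two prefixes of length m.\<close>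

type_synonym evaluator = "leaf_rule list \<Rightarrow> num \<Rightarrow> bool list \<Rightarrow> bool list \<Rightarrow> bool list \<Rightarrow> num"

text \<open>Position m is settled once both lists have length m + 1. Its flag leaves the window, and
  a miss drops the rule for the present number of misses.\<close>

fun child :: "evaluator \<Rightarrow> leaf_rule \<Rightarrow> evaluator" where
  "child F r rs s (True # hs) xs ys = F (r # rs) s hs xs ys"
| "child F r rs s (False # hs) xs ys = F rs s hs xs ys"
| "child F r rs s [] xs ys = num.One"

fun split_node :: "evaluator \<Rightarrow> leaf_rule \<Rightarrow> leaf_rule list \<Rightarrow> num \<Rightarrow> bool list \<Rightarrow>
    bool list \<Rightarrow> bool list \<Rightarrow> bool list \<Rightarrow> bool list \<Rightarrow> num" where
  "split_node F r rs s hs xs1 xs0 ys1 ys0 =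
    (child F r rs s (or_list (or_list hs xs1) ys1) xs1 ys1 + child F r rs s (or_list hs ys0) xs1 ys0) +
    (child F r rs s (or_list hs xs0) xs0 ys1 + child F r rs s hs xs0 ys0)"

text \<open>The four children share the mass equally, so a mass not divisible by 4 forces a leaf.
  Two flags are appended because the window m, ..., 2m - 1 must reach 2m + 1 before
  \<open>child\<close> consumes its first entry.\<close>

fun decide_node :: "bool \<Rightarrow> num \<Rightarrow> evaluator \<Rightarrow> leaf_rule \<Rightarrow> evaluator" where
  "decide_node False t F r rs (num.Bit0 (num.Bit0 s)) hs xs ys =
    split_node F r rs s (hs @ [False, False]) (xs @ [True]) (xs @ [False]) (ys @ [True]) (ys @ [False])"
| "decide_node _ t F r rs s hs xs ys = leaf_bound r s t hs xs ys"

fun test_node :: "num \<Rightarrow> evaluator \<Rightarrow> leaf_rule \<Rightarrow> evaluator" where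
  "test_node t F r rs s hs xs ys = decide_node (t \<le> cutoff r) t F r rs s hs xs ys"

text \<open>The value of \<open>tail_bound\<close> is passed on as an argument because both the
  cutoff test and the leaf bound may need it; rewriting then computes it once. With no rules left, f
  is at most c for this and all larger miss counts.\<close>

fun eval_node :: "num \<Rightarrow> evaluator \<Rightarrow> evaluator" where
  "eval_node c F [] s hs xs ys = s * c"
| "eval_node c F (r # rs) s hs xs ys = test_node (tail_bound hs xs ys s) F r rs s hs xs ys"

fun stop_node :: "num \<Rightarrow> evaluator" where
  "stop_node c [] s hs xs ys = s * c"
| "stop_node c (r # rs) s hs xs ys = leaf_bound r s (tail_bound hs xs ys s) hs xs ys"

primrec eval_tree :: "nat \<Rightarrow> num \<Rightarrow> evaluator" where
  "eval_tree 0 c = stop_node c"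
| "eval_tree (Suc n) c = eval_node c (eval_tree n c)"

section \<open>Correctness of the tree bounds\<close>

definition future_hits :: "bool list \<Rightarrow> bool list \<Rightarrow> bool list \<Rightarrow> bool" where
  "future_hits hs xs ys \<longleftrightarrow> length ys = length xs \<and> length hs = length xs \<and>
    (\<forall>i<length xs. hs ! i \<longleftrightarrow> hit xs ys (length xs + i))"

fun valid_rule :: "(nat \<Rightarrow> real) \<Rightarrow> nat \<Rightarrow> leaf_rule \<Rightarrow> bool" where
  "valid_rule f k (Const _ \<alpha>) \<longleftrightarrow> (\<forall>t. f (k + t) \<le> numeral \<alpha>)"
| "valid_rule f k (Linear _ \<alpha> \<beta>) \<longleftrightarrow> (\<forall>t. f (k + t) \<le> numeral \<alpha> + numeral \<beta> * real t)"
| "valid_rule f k (Unless_Miss _ \<alpha> \<gamma>) \<longleftrightarrow>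
    (\<forall>t. f (k + t) \<le> numeral \<alpha> + numeral \<gamma> * of_bool (t = 0))"

fun valid_rules :: "num \<Rightarrow> (nat \<Rightarrow> real) \<Rightarrow> nat \<Rightarrow> leaf_rule list \<Rightarrow> bool" where
  "valid_rules c f k [] \<longleftrightarrow> (\<forall>t. f (k + t) \<le> numeral c)"
| "valid_rules c f k (r # rs) \<longleftrightarrow> valid_rule f k r \<and> valid_rules c f (Suc k) rs"

definition tree_avg :: "(nat \<Rightarrow> real) \<Rightarrow> bool list \<Rightarrow> bool list \<Rightarrow> nat \<Rightarrow> real" where
  "tree_avg f xs ys d = ext_avg d (\<lambda>as bs. f (misses (length xs + d) as bs)) xs ys"

text \<open>Only large d can be demanded, since \<open>Unless_Miss\<close> refers to one later
  position, which must lie among the next d. The inequality is homogeneous in the mass, so s is not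
  tied to the depth.\<close>

definition sound_evaluator :: "num \<Rightarrow> (nat \<Rightarrow> real) \<Rightarrow> evaluator \<Rightarrow> bool" where
  "sound_evaluator c f F \<longleftrightarrow> (\<forall>rs s hs xs ys. future_hits hs xs ys \<longrightarrow>
    valid_rules c f (misses (length xs) xs ys) rs \<longrightarrow>
    (\<forall>\<^sub>F d in sequentially. numeral s * tree_avg f xs ys d \<le> numeral (F rs s hs xs ys)))"

lemma numeral_Bit0_eq_double: "(numeral (num.Bit0 k) :: real) = 2 * numeral k"
  by (rule trans[OF numeral_Bit0 mult_2[symmetric]])

lemma halve_ge: "half_if b * numeral n \<le> (numeral (halve b n) :: real)"
proof (cases "b \<and> (\<exists>k. n = num.Bit0 k)")
  case True
  then obtain k where k: "b = True" "n = num.Bit0 k" by auto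
  have "half_if b * (2 * x) \<le> x" for x :: real by (simp add: half_if_def k)
  then show ?thesis
    unfolding k halve.simps by (subst numeral_Bit0_eq_double)
next
  case False
  then have "halve b n = n" by (cases b; cases n) auto
  then show ?thesis by (simp add: half_if_def)
qed

lemma halve_halve_ge: "half_if a * half_if b * numeral n \<le> (numeral (halve a (halve b n)) :: real)"
proof -
  have "half_if a * half_if b * numeral n \<le> half_if a * (numeral (halve b n) :: real)"
    unfolding mult.assoc by (intro mult_left_mono halve_ge) (simp add: half_if_def)
  then show ?thesis using halve_ge order_trans by blast
qed

lemma tail_weight_nonneg: "tail_weight hs xs ys \<ge> 0"
  by (induction hs arbitrary: xs ys) (auto simp: half_if_def)

lemma numeral_triple: "numeral (n + num.Bit0 n) = (3::real) * numeral n"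
proof -
  have "x + 2 * x = 3 * x" for x :: real by simp
  then show ?thesis by (subst numeral_add, subst numeral_Bit0_eq_double)
qed

lemma tail_bound_ge:
  assumes "length xs = length hs" "length ys = length hs"
  shows "tail_weight hs xs ys * numeral n \<le> numeral (tail_bound hs xs ys n)"
  using assms
proof (induction hs xs ys n rule: tail_bound.induct)
  case (1 hs a as b bs n)
  have "half_if a * half_if b * numeral n * tail_weight hs as bs \<le>
      numeral (halve a (halve b n)) * tail_weight hs as bs"
    by (intro mult_right_mono halve_halve_ge tail_weight_nonneg)
  with 1 show ?case by (simp add: mult_ac)
next
  case (2 hs a as b bs n)
  have "half_if a * half_if b * numeral n * (1 + tail_weight hs as bs) \<le>
      numeral (halve a (halve b n)) * (1 + tail_weight hs as bs)"
    by (intro mult_right_mono halve_halve_ge add_nonneg_nonneg tail_weight_nonneg) auto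
  also have "\<dots> = numeral (halve a (halve b n)) + tail_weight hs as bs * numeral (halve a (halve b n))"
    by (simp only: distrib_right mult_1_left mult.commute)
  also have "\<dots> \<le> numeral (halve a (halve b n)) + numeral (tail_bound hs as bs (halve a (halve b n)))"
    using 2 by (intro add_left_mono) simp
  finally show ?case
    by (simp only: tail_bound.simps numeral_add tail_weight.simps list.sel not_False_eq_True of_bool_eq mult_ac)
next
  case (3 xs ys n)
  show ?case by (simp only: tail_weight.simps tail_bound.simps numeral_triple order_refl)
qed simp_all

text \<open>The miss probability of the first position among m, ..., 2m - 1 not yet hit, or 0 if
  there is none. As \<open>prefix_weight\<close> does not increase with the index, this is the
  likeliest miss among them.\<close>

primrec first_miss_weight :: "bool list \<Rightarrow> bool list \<Rightarrow> bool list \<Rightarrow> real" where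
  "first_miss_weight [] xs ys = 0"
| "first_miss_weight (h # hs) xs ys =
    half_if (hd xs) * half_if (hd ys) * (if h then first_miss_weight hs (tl xs) (tl ys) else 1)"

lemma first_miss_weight_cases:
  assumes "length xs = length hs" "length ys = length hs"
  shows "first_miss_weight hs xs ys = 0 \<or> (\<exists>i<length hs. \<not> hs ! i \<and>
    first_miss_weight hs xs ys = prefix_weight xs (Suc i) * prefix_weight ys (Suc i))"
  using assms
proof (induction hs arbitrary: xs ys)
  case (Cons h hs)
  then obtain x xs' y ys' where xy: "xs = x # xs'" "ys = y # ys'"
    by (metis length_Suc_conv)
  show ?case
  proof (cases h)
    case True
    from Cons.IH[of xs' ys'] Cons.prems consider "first_miss_weight hs xs' ys' = 0" |
      i where "i < length hs" "\<not> hs ! i"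
        "first_miss_weight hs xs' ys' = prefix_weight xs' (Suc i) * prefix_weight ys' (Suc i)"
      unfolding xy by auto
    then show ?thesis
    proof cases
      case 1
      with True show ?thesis unfolding xy by simp
    next
      case (2 i)
      with True show ?thesis
        unfolding xy by (intro disjI2 exI[of _ "Suc i"]) (simp add: prefix_weight_Cons)
    qed
  next
    case False
    then show ?thesis
      unfolding xy by (intro disjI2 exI[of _ 0]) (simp add: prefix_weight_def)
  qed
qed simp

lemma add_half_ge:
  assumes "numeral (halve b n) * (1 - p) \<le> (numeral k :: real)" "p \<le> 1"
  shows "numeral n * (1 - half_if b * p) \<le> (numeral (add_half b n k) :: real)"
proof (cases b)
  case True
  have "numeral n * (1 - half_if b * p) = half_if b * numeral n * (2 - p)"
    using True by (simp add: half_if_def algebra_simps)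
  also have "\<dots> \<le> numeral (halve b n) * (2 - p)"
    using assms(2) by (intro mult_right_mono halve_ge) auto
  also have "\<dots> \<le> numeral (add_half b n k)"
  proof -
    have "x * (2 - p) \<le> x + y" if "x * (1 - p) \<le> y" for x y :: real
      using that by (simp add: algebra_simps)
    from this[OF assms(1)] show ?thesis
      using True by (simp only: add_half.simps numeral_add)
  qed
  finally show ?thesis .
qed (use assms in \<open>simp add: half_if_def\<close>)

lemma first_miss_weight_bounds: "0 \<le> first_miss_weight hs xs ys \<and> first_miss_weight hs xs ys \<le> 1"
proof (induction hs arbitrary: xs ys)
  case (Cons h hs)
  have "half_if a * half_if b * p \<le> 1" if "p \<le> 1" for a b p
    using that by (auto simp: half_if_def)
  with Cons show ?case by (simp add: half_if_pos less_imp_le)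
qed simp

lemma no_miss_bound_ge:
  assumes "length xs = length hs" "length ys = length hs"
  shows "numeral n * (1 - first_miss_weight hs xs ys) \<le> numeral (no_miss_bound hs xs ys n)"
  using assms
proof (induction hs xs ys n rule: no_miss_bound.induct)
  case (1 hs a as b bs n)
  let ?p = "first_miss_weight hs as bs"
  have p: "0 \<le> ?p" "?p \<le> 1"
    using first_miss_weight_bounds by auto
  then have "half_if b * ?p \<le> 1"
    by (auto simp: half_if_def)
  moreover have "numeral (halve a n) * (1 - half_if b * ?p) \<le>
      numeral (add_half b (halve a n) (no_miss_bound hs as bs (halve b (halve a n))))"
    using 1 p by (intro add_half_ge) simp_all
  ultimately have "numeral n * (1 - half_if a * (half_if b * ?p)) \<le>
      numeral (no_miss_bound (True # hs) (a # as) (b # bs) n)"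
    unfolding no_miss_bound.simps by (rule add_half_ge[rotated])
  then show ?case by (simp add: mult.assoc)
next
  case (2 hs a as b bs n)
  have "numeral (halve a n) * (1 - half_if b * 1) \<le> (numeral (add_half b (halve a n) num.One) :: real)"
    by (intro add_half_ge) simp_all
  then have "numeral n * (1 - half_if a * (half_if b * 1)) \<le>
      (numeral (no_miss_bound (False # hs) (a # as) (b # bs) n) :: real)"
    unfolding no_miss_bound.simps by (intro add_half_ge) (simp_all add: half_if_def)
  then show ?case by simp
qed auto

lemma decide_node_stop:
  "b \<or> (\<forall>s'. s \<noteq> num.Bit0 (num.Bit0 s')) \<Longrightarrow> decide_node b t F r rs s hs xs ys = leaf_bound r s t hs xs ys"
  by (cases "(b, t, F, r, rs, s, hs, xs, ys)" rule: decide_node.cases) auto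

lemma leaf_bound_ge:
  assumes fh: "future_hits hs xs ys" and rule: "valid_rule f (misses (length xs) xs ys) r"
  shows "\<forall>\<^sub>F d in sequentially. numeral s * tree_avg f xs ys d \<le>
    numeral (leaf_bound r s (tail_bound hs xs ys s) hs xs ys)"
proof -
  define m where "m = length xs"
  have len: "length xs = m" "length ys = m" "length hs = m"
    and hs: "\<And>i. i < m \<Longrightarrow> hs ! i \<longleftrightarrow> hit xs ys (m + i)"
    using fh by (auto simp: future_hits_def m_def)
  show ?thesis
  proof (cases r)
    case (Const t \<alpha>)
    have "tree_avg f xs ys d \<le> numeral \<alpha>" for d
      using ext_avg_linear_bound[of xs m ys f "numeral \<alpha>" 0 d] rule len Const
      by (simp add: tree_avg_def)
    then have "numeral s * tree_avg f xs ys d \<le> numeral s * numeral \<alpha>" for d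
      by (intro mult_left_mono) auto
    then show ?thesis
      by (simp only: Const leaf_bound.simps numeral_mult eventually_True)
  next
    case (Linear t \<alpha> \<beta>)
    have "numeral s * tree_avg f xs ys d \<le>
        numeral s * numeral \<alpha> + numeral (tail_bound hs xs ys s) * numeral \<beta>" for d
    proof -
      have "tree_avg f xs ys d \<le> numeral \<alpha> + numeral \<beta> * (\<Sum>j\<in>{m..<m + d}. miss_prob xs ys j)"
        using ext_avg_linear_bound[of xs m ys f "numeral \<alpha>" "numeral \<beta>" d] rule len Linear
        by (simp add: tree_avg_def)
      also have "\<dots> \<le> numeral \<alpha> + numeral \<beta> * tail_weight hs xs ys"
        using sum_miss_prob_le_tail_weight[OF len hs] by (intro add_left_mono mult_left_mono) auto
      finally have "numeral s * tree_avg f xs ys d \<le>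
          numeral s * (numeral \<alpha> + numeral \<beta> * tail_weight hs xs ys)"
        by (intro mult_left_mono) auto
      also have "\<dots> = numeral s * numeral \<alpha> + (tail_weight hs xs ys * numeral s) * numeral \<beta>"
        by (simp only: distrib_left mult_ac)
      also have "\<dots> \<le> numeral s * numeral \<alpha> + numeral (tail_bound hs xs ys s) * numeral \<beta>"
        using len by (intro add_left_mono mult_right_mono tail_bound_ge) auto
      finally show ?thesis .
    qed
    then show ?thesis
      by (simp only: Linear leaf_bound.simps numeral_mult numeral_add eventually_True)
  next
    case (Unless_Miss t \<alpha> \<gamma>)
    have f: "f (misses m xs ys + t) \<le> numeral \<alpha> + numeral \<gamma> * of_bool (t = 0)" for t
      using rule Unless_Miss len by simp
    let ?p = "first_miss_weight hs xs ys"
    have "\<exists>D. \<forall>d\<ge>D. tree_avg f xs ys d \<le> numeral \<alpha> + numeral \<gamma> * (1 - ?p)"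
    proof -
      consider "?p = 0" | i where "i < m" "\<not> hs ! i"
          "?p = prefix_weight xs (Suc i) * prefix_weight ys (Suc i)"
        using first_miss_weight_cases[of xs hs ys] len by auto
      then show ?thesis
      proof cases
        case 1
        have "f (misses m xs ys + t) \<le> numeral \<alpha> + numeral \<gamma> + 0 * real t" for t
        proof -
          have "numeral \<gamma> * of_bool (t = 0) \<le> (numeral \<gamma> :: real)"
            by simp
          with f[of t] show ?thesis by linarith
        qed
        from ext_avg_linear_bound[OF len(1,2) this] 1 show ?thesis
          by (simp add: tree_avg_def len)
      next
        case (2 i)
        then have "miss_prob xs ys (m + i) = ?p"
          using len hs by (simp add: miss_prob_near)
        with ext_avg_first_miss_bound[OF len(1,2) f, of "m + i"] 2 show ?thesis
          by (intro exI[of _ m]) (auto simp: tree_avg_def len)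
      qed
    qed
    then obtain D where D: "\<And>d. d \<ge> D \<Longrightarrow> tree_avg f xs ys d \<le> numeral \<alpha> + numeral \<gamma> * (1 - ?p)"
      by blast
    have "numeral s * tree_avg f xs ys d \<le>
        numeral s * numeral \<alpha> + numeral (no_miss_bound hs xs ys s) * numeral \<gamma>" if "d \<ge> D" for d
    proof -
      have "numeral s * tree_avg f xs ys d \<le> numeral s * (numeral \<alpha> + numeral \<gamma> * (1 - ?p))"
        using D[OF that] by (intro mult_left_mono) auto
      also have "\<dots> = numeral s * numeral \<alpha> + (numeral s * (1 - ?p)) * numeral \<gamma>"
        by (simp only: distrib_left mult_ac)
      also have "\<dots> \<le> numeral s * numeral \<alpha> + numeral (no_miss_bound hs xs ys s) * numeral \<gamma>"
        using len by (intro add_left_mono mult_right_mono no_miss_bound_ge) auto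
      finally show ?thesis .
    qed
    then show ?thesis
      unfolding eventually_sequentially
      unfolding Unless_Miss leaf_bound.simps numeral_mult numeral_add by blast
  qed
qed

lemma sound_stop_node: "sound_evaluator c f (stop_node c)"
  unfolding sound_evaluator_def
proof (intro allI impI)
  fix rs s hs xs ys
  assume fh: "future_hits hs xs ys" and valid: "valid_rules c f (misses (length xs) xs ys) rs"
  show "\<forall>\<^sub>F d in sequentially. numeral s * tree_avg f xs ys d \<le> numeral (stop_node c rs s hs xs ys)"
  proof (cases rs)
    case Nil
    then show ?thesis
      \<comment> \<open>An auxiliary \<open>Const\<close> rule with an arbitrary cutoff covers the
        empty rule list.\<close>
      using leaf_bound_ge[OF fh, of f "Const num.One c" s] valid by simp
  next
    case (Cons r rs')
    then show ?thesis
      using leaf_bound_ge[OF fh, of f r s] valid by simp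
  qed
qed

lemma tree_avg_Suc:
  "tree_avg f xs ys (Suc d) =
    (tree_avg f (xs @ [True]) (ys @ [True]) d + tree_avg f (xs @ [True]) (ys @ [False]) d +
     tree_avg f (xs @ [False]) (ys @ [True]) d + tree_avg f (xs @ [False]) (ys @ [False]) d) / 4"
  by (simp add: tree_avg_def ext_avg_Suc)

lemma length_or_list [simp]: "length (or_list hs xs) = length hs"
  by (induction hs xs rule: or_list.induct) auto

lemma nth_or_list: "i < length hs \<Longrightarrow> or_list hs xs ! i \<longleftrightarrow> hs ! i \<or> bit_at xs i"
proof (induction hs xs arbitrary: i rule: or_list.induct)
  case (1 h hs xs)
  then show ?case by (cases i) (auto simp: bit_at_def)
next
  case (2 h hs xs)
  then show ?case by (cases i) (auto simp: bit_at_def)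
qed (auto simp: bit_at_def)

text \<open>A new pair of indices with sum m + i uses the new index m of one list, hence index i of
  the other.\<close>

lemma hit_snoc:
  assumes "length xs = m" "length ys = m"
  shows "hit (xs @ [a]) (ys @ [b]) (m + i) \<longleftrightarrow>
    hit xs ys (m + i) \<or> a \<and> bit_at (ys @ [b]) i \<or> b \<and> bit_at (xs @ [a]) i"
proof
  assume "hit (xs @ [a]) (ys @ [b]) (m + i)"
  then obtain l where l: "l \<le> m + i" "bit_at (xs @ [a]) l" "bit_at (ys @ [b]) (m + i - l)"
    by (auto simp: hit_def)
  consider "l = m" | "m + i - l = m" | "l < m" "m + i - l < m"
    using l assms by (fastforce simp: bit_at_def)
  then show "hit xs ys (m + i) \<or> a \<and> bit_at (ys @ [b]) i \<or> b \<and> bit_at (xs @ [a]) i"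
  proof cases
    case 3
    then have "hit xs ys (m + i)"
      using l assms unfolding hit_def by (intro exI[of _ l]) (auto simp: bit_at_def nth_append)
    then show ?thesis ..
  next
    case 2
    then have "l = i" using l by simp
    with 2 l assms show ?thesis by (auto simp: bit_at_def nth_append)
  qed (use l assms in \<open>auto simp: bit_at_def\<close>)
next
  assume "hit xs ys (m + i) \<or> a \<and> bit_at (ys @ [b]) i \<or> b \<and> bit_at (xs @ [a]) i"
  then consider "hit xs ys (m + i)" | "a" "bit_at (ys @ [b]) i" | "b" "bit_at (xs @ [a]) i"
    by blast
  then show "hit (xs @ [a]) (ys @ [b]) (m + i)"
  proof cases
    case 1
    then obtain l where "l \<le> m + i" "bit_at xs l" "bit_at ys (m + i - l)"
      by (auto simp: hit_def)
    then show ?thesis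
      unfolding hit_def by (intro exI[of _ l]) (auto simp: bit_at_def nth_append)
  next
    case 2
    then show ?thesis
      unfolding hit_def using assms by (intro exI[of _ m]) (auto simp: bit_at_def nth_append)
  next
    case 3
    then show ?thesis
      unfolding hit_def using assms by (intro exI[of _ i]) (auto simp: bit_at_def nth_append)
  qed
qed

lemma misses_snoc:
  assumes "length xs = m" "length ys = m"
  shows "misses (Suc m) (xs @ [a]) (ys @ [b]) =
    (if hit (xs @ [a]) (ys @ [b]) m then misses m xs ys else Suc (misses m xs ys))"
proof -
  have "{j. m \<le> j \<and> j < m + 1 \<and> \<not> hit (xs @ [a]) (ys @ [b]) j} =
      (if hit (xs @ [a]) (ys @ [b]) m then {} else {m})"
    by (auto simp: less_Suc_eq)
  then show ?thesis
    using misses_split[of m 1 "xs @ [a]" "ys @ [b]"] assms by (simp add: misses_append)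
qed

lemma sound_child:
  assumes sound: "sound_evaluator c f F" and len: "length xs = m" "length ys = m" "length gs = m + 2"
    and gs: "\<And>i. i < m + 2 \<Longrightarrow> gs ! i \<longleftrightarrow> hit (xs @ [a]) (ys @ [b]) (m + i)"
    and valid: "valid_rules c f (misses m xs ys) (r # rs)"
  shows "\<forall>\<^sub>F d in sequentially. numeral s * tree_avg f (xs @ [a]) (ys @ [b]) d \<le>
    numeral (child F r rs s gs (xs @ [a]) (ys @ [b]))"
proof -
  obtain g gs' where g: "gs = g # gs'"
    using len by (cases gs) auto
  have "future_hits gs' (xs @ [a]) (ys @ [b])"
    unfolding future_hits_def
  proof (intro conjI allI impI)
    fix i assume "i < length (xs @ [a])"
    then show "gs' ! i \<longleftrightarrow> hit (xs @ [a]) (ys @ [b]) (length (xs @ [a]) + i)"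
      using gs[of "Suc i"] len by (simp add: g)
  qed (use len g in auto)
  moreover have "g \<longleftrightarrow> hit (xs @ [a]) (ys @ [b]) m"
    using gs[of 0] by (simp add: g)
  ultimately show ?thesis
    using sound len valid unfolding sound_evaluator_def g by (cases g) (simp_all add: misses_snoc)
qed

lemma sound_eval_node:
  assumes sound: "sound_evaluator c f F"
  shows "sound_evaluator c f (eval_node c F)"
  unfolding sound_evaluator_def
proof (intro allI impI)
  fix rs s hs xs ys
  assume fh: "future_hits hs xs ys" and valid: "valid_rules c f (misses (length xs) xs ys) rs"
  define m where "m = length xs"
  have len: "length xs = m" "length ys = m" "length hs = m"
    and hs: "\<And>i. i < m \<Longrightarrow> hs ! i \<longleftrightarrow> hit xs ys (m + i)"
    using fh by (auto simp: future_hits_def m_def)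
  let ?stop = "\<forall>\<^sub>F d in sequentially. numeral s * tree_avg f xs ys d \<le> numeral (stop_node c rs s hs xs ys)"
  have stop: ?stop
    using sound_stop_node fh valid unfolding sound_evaluator_def by blast
  show "\<forall>\<^sub>F d in sequentially. numeral s * tree_avg f xs ys d \<le> numeral (eval_node c F rs s hs xs ys)"
  proof (cases "\<exists>r rs' s'. rs = r # rs' \<and> s = num.Bit0 (num.Bit0 s') \<and> \<not> tail_bound hs xs ys s \<le> cutoff r")
    case False
    then have "eval_node c F rs s hs xs ys = stop_node c rs s hs xs ys"
      by (cases rs) (auto intro!: decide_node_stop)
    with stop show ?thesis by simp
  next
    case True
    then obtain r rs' s' where rs: "rs = r # rs'" and s: "s = num.Bit0 (num.Bit0 s')"
      and big: "\<not> tail_bound hs xs ys s \<le> cutoff r" by blast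
    let ?gs = "hs @ [False, False]"
    \<comment> \<open>Two indices below m sum to at most 2m - 2, so the appended flags for 2m and 2m
      + 1 are rightly False.\<close>
    have gs: "?gs ! i \<longleftrightarrow> hit xs ys (m + i)" if "i < m + 2" for i
    proof (cases "i < m")
      case False
      then have "\<not> hit xs ys (m + i)"
        using len by (auto simp: hit_def bit_at_def)
      then show ?thesis
        using that len False by (auto simp: nth_append nth_Cons')
    qed (use len hs in \<open>auto simp: nth_append\<close>)
    have eval_eq: "eval_node c F rs s hs xs ys =
      split_node F r rs' s' ?gs (xs @ [True]) (xs @ [False]) (ys @ [True]) (ys @ [False])"
      using big by (simp add: rs s)
    have s_eq: "numeral s = 4 * (numeral s' :: real)"
    proof -
      have "2 * (2 * x) = 4 * x" for x :: real by simp
      then show ?thesis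
        unfolding s numeral_Bit0_eq_double[of "num.Bit0 s'"] numeral_Bit0_eq_double[of s'] .
    qed
    note child = sound_child[OF sound len(1,2), where rs = rs' and r = r and s = s']
    have "\<forall>\<^sub>F d in sequentially. numeral s' * tree_avg f (xs @ [True]) (ys @ [True]) d \<le>
        numeral (child F r rs' s' (or_list (or_list ?gs (xs @ [True])) (ys @ [True])) (xs @ [True]) (ys @ [True]))"
      using len valid gs unfolding rs by (intro child) (auto simp: nth_or_list hit_snoc)
    moreover have "\<forall>\<^sub>F d in sequentially. numeral s' * tree_avg f (xs @ [True]) (ys @ [False]) d \<le>
        numeral (child F r rs' s' (or_list ?gs (ys @ [False])) (xs @ [True]) (ys @ [False]))"
      using len valid gs unfolding rs by (intro child) (auto simp: nth_or_list hit_snoc)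
    moreover have "\<forall>\<^sub>F d in sequentially. numeral s' * tree_avg f (xs @ [False]) (ys @ [True]) d \<le>
        numeral (child F r rs' s' (or_list ?gs (xs @ [False])) (xs @ [False]) (ys @ [True]))"
      using len valid gs unfolding rs by (intro child) (auto simp: nth_or_list hit_snoc)
    moreover have "\<forall>\<^sub>F d in sequentially. numeral s' * tree_avg f (xs @ [False]) (ys @ [False]) d \<le>
        numeral (child F r rs' s' ?gs (xs @ [False]) (ys @ [False]))"
      using len valid gs unfolding rs by (intro child) (auto simp: hit_snoc)
    ultimately have "\<forall>\<^sub>F d in sequentially. numeral s * tree_avg f xs ys (Suc d) \<le>
        numeral (eval_node c F rs s hs xs ys)"
    proof eventually_elim
      case (elim d)
      have 4: "4 * x * ((p + q + r + t) / 4) = (x * p + x * q) + (x * r + x * t)" for x p q r t :: real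
        by (simp add: algebra_simps)
      show ?case
        unfolding eval_eq s_eq split_node.simps numeral_add tree_avg_Suc 4
        by (intro add_mono elim(1-4))
    qed
    then show ?thesis
      by (rule eventually_sequentially_Suc[THEN iffD1])
  qed
qed

lemma sound_eval_tree: "sound_evaluator c f (eval_tree n c)"
  by (induction n) (simp_all add: sound_stop_node sound_eval_node)

section \<open>Missing differences of random sets\<close>

definition set_of_bits :: "bool list \<Rightarrow> int set" where
  "set_of_bits xs = {int i | i. bit_at xs i}"

lemma bij_betw_set_of_bits: "bij_betw set_of_bits (blists n) (Pow {0..<int n})"
proof (rule bij_betwI[where g = "\<lambda>S. map (\<lambda>i. int i \<in> S) [0..<n]"])
  show "set_of_bits \<in> blists n \<rightarrow> Pow {0..<int n}"
    by (auto simp: set_of_bits_def bit_at_def blists_def)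
  show "(\<lambda>S. map (\<lambda>i. int i \<in> S) [0..<n]) \<in> Pow {0..<int n} \<rightarrow> blists n"
    by (auto simp: blists_def)
  show "map (\<lambda>i. int i \<in> set_of_bits xs) [0..<n] = xs" if "xs \<in> blists n" for xs
    using that by (auto simp: blists_def set_of_bits_def bit_at_def intro!: nth_equalityI)
  show "set_of_bits (map (\<lambda>i. int i \<in> S) [0..<n]) = S" if "S \<in> Pow {0..<int n}" for S
  proof (rule set_eqI)
    fix z
    show "z \<in> set_of_bits (map (\<lambda>i. int i \<in> S) [0..<n]) \<longleftrightarrow> z \<in> S"
    proof
      assume "z \<in> S"
      moreover from this that have "0 \<le> z" "z < int n" by auto
      ultimately show "z \<in> set_of_bits (map (\<lambda>i. int i \<in> S) [0..<n])"
        unfolding set_of_bits_def by (auto simp: bit_at_def intro!: exI[of _ "nat z"])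
    qed (auto simp: set_of_bits_def bit_at_def)
  qed
qed

lemma hit_rev:
  assumes "length xs = n" "t < n"
  shows "hit xs (rev xs) t \<longleftrightarrow> (\<exists>i\<le>t. xs ! i \<and> xs ! (i + (n - 1 - t)))"
proof -
  have "bit_at xs i \<and> bit_at (rev xs) (t - i) \<longleftrightarrow> xs ! i \<and> xs ! (i + (n - 1 - t))" if "i \<le> t" for i
  proof -
    have "rev xs ! (t - i) = xs ! (i + (n - 1 - t))"
    proof -
      have "n - Suc (t - i) = i + (n - 1 - t)"
        using that assms by linarith
      then show ?thesis
        using that assms by (simp add: rev_nth)
    qed
    then show ?thesis
      using that assms by (auto simp: bit_at_def)
  qed
  then show ?thesis by (auto simp: hit_def)
qed

lemma hit_rev_iff_diff:
  assumes "length xs = n" "t < n"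
  shows "hit xs (rev xs) t \<longleftrightarrow> int (n - 1 - t) \<in> diff_set (set_of_bits xs)"
proof
  assume "hit xs (rev xs) t"
  then obtain i where "i \<le> t" "xs ! i" "xs ! (i + (n - 1 - t))"
    using hit_rev[OF assms] by auto
  then have "bit_at xs (i + (n - 1 - t))" "bit_at xs i"
    using assms by (auto simp: bit_at_def)
  then have "int (i + (n - 1 - t)) \<in> set_of_bits xs" "int i \<in> set_of_bits xs"
    unfolding set_of_bits_def by blast+
  then show "int (n - 1 - t) \<in> diff_set (set_of_bits xs)"
  proof -
    have "int (n - 1 - t) = int (i + (n - 1 - t)) - int i" by simp
    then show ?thesis
      unfolding diff_set_def using \<open>int (i + (n - 1 - t)) \<in> set_of_bits xs\<close> \<open>int i \<in> set_of_bits xs\<close> by blast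
  qed
next
  assume "int (n - 1 - t) \<in> diff_set (set_of_bits xs)"
  then obtain a b where ab: "bit_at xs a" "bit_at xs b" "int (n - 1 - t) = int a - int b"
    by (auto simp: diff_set_def set_of_bits_def)
  then have a: "a = b + (n - 1 - t)" by linarith
  with ab assms have "b \<le> t" by (auto simp: bit_at_def)
  then show "hit xs (rev xs) t"
    using ab a assms by (auto simp: hit_rev bit_at_def)
qed

text \<open>For nonempty S the difference set consists of 0 and pairs z, -z, so missing differences
  come in twos; this is the source of the parity statement. The empty set is the only
  exception.\<close>

lemma card_diff_set:
  assumes len: "length xs = n" and ne: "set_of_bits xs \<noteq> {}"
  shows "int (card (diff_set (set_of_bits xs))) = 2 * int n - 1 - 2 * int (misses n xs (rev xs))"
proof -
  let ?D = "diff_set (set_of_bits xs)"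
  let ?H = "{t. t < n - 1 \<and> hit xs (rev xs) t}"
  define P where "P = (\<lambda>t. int (n - 1 - t)) ` ?H"
  from ne len have "n > 0" by (auto simp: set_of_bits_def bit_at_def)
  have zero: "0 \<in> ?D"
    using ne by (force simp: diff_set_def)
  have sym: "- z \<in> ?D" if "z \<in> ?D" for z
    using that unfolding diff_set_def by force
  have pos: "z \<in> P" if z: "z \<in> ?D" "z > 0" for z
  proof -
    from z(1) obtain a b where ab: "bit_at xs a" "bit_at xs b" "z = int a - int b"
      by (auto simp: diff_set_def set_of_bits_def)
    define t where "t = n - 1 - nat z"
    have "z < int n" using ab len by (auto simp: bit_at_def)
    then have t: "t < n - 1" "z = int (n - 1 - t)"
      using z(2) by (auto simp: t_def)
    with z(1) have "hit xs (rev xs) t"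
      using hit_rev_iff_diff[OF len, of t] by simp
    with t(1) show ?thesis unfolding P_def t(2) by (intro imageI) simp
  qed
  have P_sub: "P \<subseteq> ?D" "\<And>z. z \<in> P \<Longrightarrow> z > 0"
    using hit_rev_iff_diff[OF len] by (auto simp: P_def)
  have D_eq: "?D = insert 0 (P \<union> uminus ` P)"
  proof (intro set_eqI iffI)
    fix z assume z: "z \<in> ?D"
    consider "z = 0" | "z > 0" | "- z > 0" by linarith
    then show "z \<in> insert 0 (P \<union> uminus ` P)"
    proof cases
      case 3
      with pos[OF sym[OF z]] have "- z \<in> P" by simp
      then have "z \<in> uminus ` P" by (metis image_eqI minus_minus)
      then show ?thesis by simp
    qed (use pos z in auto)
  next
    fix z assume "z \<in> insert 0 (P \<union> uminus ` P)"
    then show "z \<in> ?D" using zero sym P_sub by auto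
  qed
  have finP: "finite P" by (simp add: P_def)
  have "card P = card ?H"
    unfolding P_def by (intro card_image) (auto simp: inj_on_def)
  moreover have "card (insert 0 (P \<union> uminus ` P)) = Suc (card P + card P)"
  proof -
    have "z \<notin> uminus ` P" if "z \<in> P" for z
      using P_sub(2)[OF that] P_sub(2)[of "- z"] by auto
    then have "P \<inter> uminus ` P = {}" by blast
    moreover have "0 \<notin> P \<union> uminus ` P"
      using P_sub(2)[of 0] by auto
    ultimately show ?thesis
      using finP by (simp add: card_Un_disjoint card_image)
  qed
  moreover have "card ?H + misses n xs (rev xs) = n - 1"
  proof -
    \<comment> \<open>The index t = n - 1 encodes the difference 0, which is always present and so
      adds nothing to \<open>misses\<close>.\<close>
    have "hit xs (rev xs) (n - 1)"
      using hit_rev_iff_diff[OF len, of "n - 1"] zero \<open>n > 0\<close> by simp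
    moreover have "t < n \<longleftrightarrow> t < n - 1 \<or> t = n - 1" for t
      using \<open>n > 0\<close> by linarith
    ultimately have "{t. t < n \<and> \<not> hit xs (rev xs) t} = {t. t < n - 1 \<and> \<not> hit xs (rev xs) t}"
      by blast
    moreover have "card ?H + card {t. t < n - 1 \<and> \<not> hit xs (rev xs) t} = card (?H \<union> {t. t < n - 1 \<and> \<not> hit xs (rev xs) t})"
      by (intro card_Un_disjoint[symmetric]) auto
    moreover have "?H \<union> {t. t < n - 1 \<and> \<not> hit xs (rev xs) t} = {..<n - 1}"
      by auto
    ultimately show ?thesis by (simp add: misses_def)
  qed
  ultimately show ?thesis
    unfolding D_eq using \<open>n > 0\<close> by simp
qed

lemma P_missing_eq_card:
  "P_missing n k = real (card {xs \<in> blists n. 2 * int n - 1 - int (card (diff_set (set_of_bits xs))) = int k}) / 2 ^ n"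
proof -
  let ?A = "{S. 2 * int n - 1 - int (card (diff_set S)) = int k}"
  have "P_missing n k = real (card (Pow {0..<int n} \<inter> ?A)) / 2 ^ n"
    unfolding P_missing_def by (subst measure_pmf_of_set) (auto simp: card_Pow)
  moreover have "card {xs \<in> blists n. set_of_bits xs \<in> ?A} = card (Pow {0..<int n} \<inter> ?A)"
  proof (rule bij_betw_same_card[OF bij_betw_subset[OF bij_betw_set_of_bits]])
    show "set_of_bits ` {xs \<in> blists n. set_of_bits xs \<in> ?A} = Pow {0..<int n} \<inter> ?A"
      unfolding bij_betw_imp_surj_on[OF bij_betw_set_of_bits[of n], symmetric]
      by (rule set_eqI) (auto simp only: image_iff Int_iff mem_Collect_eq)
  qed auto
  ultimately show ?thesis
    by (simp only: mem_Collect_eq)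
qed

lemma set_of_bits_empty_iff: "set_of_bits xs = {} \<longleftrightarrow> True \<notin> set xs"
  by (auto simp: set_of_bits_def bit_at_def in_set_conv_nth)

lemma P_missing_odd:
  assumes "odd k"
  shows "P_missing n k \<le> 1 / 2 ^ n"
proof -
  have "{xs \<in> blists n. 2 * int n - 1 - int (card (diff_set (set_of_bits xs))) = int k} \<subseteq> {replicate n False}"
  proof
    fix xs assume xs: "xs \<in> {xs \<in> blists n. 2 * int n - 1 - int (card (diff_set (set_of_bits xs))) = int k}"
    have "set_of_bits xs = {}"
    proof (rule ccontr)
      assume "set_of_bits xs \<noteq> {}"
      moreover from xs have "length xs = n" by (simp add: blists_def)
      ultimately have "int k = 2 * int (misses n xs (rev xs))"
        using card_diff_set[of xs n] xs by simp
      then show False using assms by presburger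
    qed
    then have "\<forall>x\<in>set xs. x = False"
      by (auto simp: set_of_bits_empty_iff)
    with xs show "xs \<in> {replicate n False}"
      by (auto simp: blists_def intro: replicate_eqI)
  qed
  then have "card {xs \<in> blists n. 2 * int n - 1 - int (card (diff_set (set_of_bits xs))) = int k} \<le> 1"
    using card_mono[of "{replicate n False}"] by fastforce
  then show ?thesis
    unfolding P_missing_eq_card by (intro divide_right_mono) auto
qed

lemma P_missing_even:
  "P_missing n (2 * k) = real (card {xs \<in> blists n. True \<in> set xs \<and> misses n xs (rev xs) = k}) / 2 ^ n"
proof -
  have "2 * int n - 1 - int (card (diff_set (set_of_bits xs))) = int (2 * k) \<longleftrightarrow>
      True \<in> set xs \<and> misses n xs (rev xs) = k" if "xs \<in> blists n" for xs
  proof (cases "set_of_bits xs = {}")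
    case True
    then have "True \<notin> set xs" "diff_set (set_of_bits xs) = {}"
      by (auto simp: set_of_bits_empty_iff[symmetric] diff_set_def)
    moreover have "2 * int n - 1 \<noteq> int (2 * k)"
      by presburger
    ultimately show ?thesis by simp
  next
    case False
    with that show ?thesis
      by (simp add: card_diff_set blists_def set_of_bits_empty_iff)
  qed
  then show ?thesis
    unfolding P_missing_eq_card by (intro arg_cong2[of _ _ _ _ "(/)"] arg_cong[of _ _ real] arg_cong[of _ _ card]) auto
qed

section \<open>The probability that a given difference is missing\<close>

lemma card_forbidden_pair:
  assumes ij: "i \<noteq> j" "i < n" "j < n"
    and Q: "\<And>xs a b. xs \<in> blists n \<Longrightarrow> Q xs \<Longrightarrow> Q (xs[i := a, j := b])"
  shows "4 * card {xs \<in> blists n. Q xs \<and> \<not> (xs ! i \<and> xs ! j)} \<le> 3 * card {xs \<in> blists n. Q xs}"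
proof -
  let ?B = "{xs \<in> blists n. Q xs \<and> xs ! i \<and> xs ! j}"
  let ?N = "{xs \<in> blists n. Q xs \<and> \<not> (xs ! i \<and> xs ! j)}"
  \<comment> \<open>Setting both bits to True while recording their old values is injective, so at
    least a quarter of the lists have both bits set.\<close>
  let ?h = "\<lambda>xs. (xs[i := True, j := True], xs ! i, xs ! j)"
  have "card {xs \<in> blists n. Q xs} \<le> card (?B \<times> (UNIV :: (bool \<times> bool) set))"
  proof (rule card_inj_on_le)
    show "inj_on ?h {xs \<in> blists n. Q xs}"
    proof (rule inj_onI)
      fix xs ys assume xy: "xs \<in> {xs \<in> blists n. Q xs}" "ys \<in> {xs \<in> blists n. Q xs}" and eq: "?h xs = ?h ys"
      show "xs = ys"
      proof (rule nth_equalityI)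
        show "length xs = length ys" using xy by (simp add: blists_def)
        fix l assume "l < length xs"
        show "xs ! l = ys ! l"
        proof (cases "l = i \<or> l = j")
          case False
          then have "xs ! l = xs[i := True, j := True] ! l" by simp
          also have "\<dots> = ys[i := True, j := True] ! l" using eq by simp
          also have "\<dots> = ys ! l" using False by simp
          finally show ?thesis .
        qed (use eq in auto)
      qed
    qed
    show "?h ` {xs \<in> blists n. Q xs} \<subseteq> ?B \<times> UNIV"
      using Q ij by (auto simp: blists_def)
  qed (auto intro: finite_subset[OF _ finite_blists[of n]])
  also have "\<dots> = 4 * card ?B"
    by (simp add: card_cartesian_product flip: UNIV_Times_UNIV)
  finally have "card {xs \<in> blists n. Q xs} \<le> 4 * card ?B" .
  moreover have "card {xs \<in> blists n. Q xs} = card ?B + card ?N"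
  proof -
    have "{xs \<in> blists n. Q xs} = ?B \<union> ?N" by auto
    then show ?thesis
      by (simp only:) (intro card_Un_disjoint, auto intro: finite_subset[OF _ finite_blists[of n]])
  qed
  ultimately show ?thesis by simp
qed

text \<open>The condition i + d \<notin> I makes the pairs i, i + d disjoint, so each costs a
  separate factor 3 / 4.\<close>

lemma card_forbidden_pairs:
  assumes "finite I" "d > 0" "\<And>i. i \<in> I \<Longrightarrow> i + d < n \<and> i + d \<notin> I"
  shows "4 ^ card I * card {xs \<in> blists n. \<forall>i\<in>I. \<not> (xs ! i \<and> xs ! (i + d))} \<le> 3 ^ card I * 2 ^ n"
  using assms
proof (induction I rule: finite_induct)
  case empty
  then show ?case by simp
next
  case (insert i I)
  let ?Q = "\<lambda>xs. \<forall>i\<in>I. \<not> (xs ! i \<and> xs ! (i + d))"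
  have step: "4 * card {xs \<in> blists n. ?Q xs \<and> \<not> (xs ! i \<and> xs ! (i + d))} \<le> 3 * card {xs \<in> blists n. ?Q xs}"
  proof (rule card_forbidden_pair)
    fix xs a b assume Q: "?Q xs"
    show "?Q (xs[i := a, i + d := b])"
    proof
      fix l assume l: "l \<in> I"
      then have "i \<noteq> l" "i + d \<noteq> l" "i \<noteq> l + d" "i + d \<noteq> l + d"
        using insert by auto
      then have "xs[i := a, i + d := b] ! l = xs ! l" "xs[i := a, i + d := b] ! (l + d) = xs ! (l + d)"
        by (simp_all only: nth_list_update_neq not_False_eq_True)
      with Q l show "\<not> (xs[i := a, i + d := b] ! l \<and> xs[i := a, i + d := b] ! (l + d))"
        by auto
    qed
  qed (use insert.prems(1) insert.prems(2)[of i] in auto)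
  have IH: "4 ^ card I * card {xs \<in> blists n. ?Q xs} \<le> 3 ^ card I * 2 ^ n"
    using insert by auto
  have set_eq: "{xs \<in> blists n. \<forall>i\<in>insert i I. \<not> (xs ! i \<and> xs ! (i + d))} =
      {xs \<in> blists n. ?Q xs \<and> \<not> (xs ! i \<and> xs ! (i + d))}"
    by auto
  have arith: "4 * p * x \<le> 3 * b" if "4 * x \<le> 3 * y" "p * y \<le> b" for p x y b :: nat
  proof -
    have "4 * p * x = p * (4 * x)" "p * (3 * y) = 3 * (p * y)" by simp_all
    with mult_le_mono2[OF that(1), of p] that(2) show ?thesis by linarith
  qed
  have card_eq: "card (insert i I) = Suc (card I)"
    using insert(1,2) by simp
  show ?case
    using arith[OF step IH] by (simp only: card_eq power_Suc set_eq mult.assoc)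
qed

text \<open>The pairs (i, i + d) with i div d even are disjoint and cover at least half of all pairs.\<close>

lemma card_even_blocks: "t + 1 \<le> 2 * card {i. i \<le> t \<and> even (i div d)}" if "d > 0" for t d :: nat
proof -
  let ?E = "{i. i \<le> t \<and> even (i div d)}" and ?O = "{i. i \<le> t \<and> odd (i div d)}"
  have ge: "d \<le> i" if "odd (i div d)" for i
    using that by (metis div_less even_zero not_le_imp_less)
  have "card ?O \<le> card ?E"
  proof (rule card_inj_on_le)
    show "inj_on (\<lambda>i. i - d) ?O"
      using ge by (auto simp: inj_on_def) (metis le_add_diff_inverse)
    show "(\<lambda>i. i - d) ` ?O \<subseteq> ?E"
    proof
      fix l assume "l \<in> (\<lambda>i. i - d) ` ?O"
      then obtain i where i: "l = i - d" "i \<le> t" "odd (i div d)" by auto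
      then have "i div d = Suc (l div d)"
        using le_div_geq[OF that ge[OF i(3)]] by simp
      with i show "l \<in> ?E" by auto
    qed
  qed auto
  moreover have "card ?O + card ?E = card (?O \<union> ?E)"
    by (intro card_Un_disjoint[symmetric]) auto
  moreover have "?O \<union> ?E = {..t}"
    by auto
  ultimately show ?thesis by simp
qed

text \<open>A missing difference n - 1 - t forbids t + 1 pairs, at least half of which can be chosen
  disjoint; the square root is the resulting factor per pair.\<close>

definition miss_rate :: real where
  "miss_rate = sqrt (3 / 4)"

lemma card_not_hit_rev_le:
  assumes "t < n - 1"
  shows "real (card {xs \<in> blists n. \<not> hit xs (rev xs) t}) \<le> miss_rate ^ (t + 1) * 2 ^ n"
proof -
  define d where "d = n - 1 - t"
  let ?I = "{i. i \<le> t \<and> even (i div d)}"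
  have d: "d > 0" "t + d < n" using assms by (auto simp: d_def)
  have sub: "{xs \<in> blists n. \<not> hit xs (rev xs) t} \<subseteq> {xs \<in> blists n. \<forall>i\<in>?I. \<not> (xs ! i \<and> xs ! (i + d))}"
    using assms by (auto simp: blists_def hit_rev d_def)
  have "4 ^ card ?I * card {xs \<in> blists n. \<forall>i\<in>?I. \<not> (xs ! i \<and> xs ! (i + d))} \<le> 3 ^ card ?I * 2 ^ n"
    using d by (intro card_forbidden_pairs) auto
  moreover have "card {xs \<in> blists n. \<not> hit xs (rev xs) t} \<le> card {xs \<in> blists n. \<forall>i\<in>?I. \<not> (xs ! i \<and> xs ! (i + d))}"
    by (intro card_mono sub) (auto intro: finite_subset[OF _ finite_blists[of n]])
  ultimately have "4 ^ card ?I * card {xs \<in> blists n. \<not> hit xs (rev xs) t} \<le> 3 ^ card ?I * 2 ^ n"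
    by (meson le_trans mult_le_mono2)
  then have "real (4 ^ card ?I * card {xs \<in> blists n. \<not> hit xs (rev xs) t}) \<le> real (3 ^ card ?I * 2 ^ n)"
    by (rule of_nat_mono)
  then have "real (card {xs \<in> blists n. \<not> hit xs (rev xs) t}) \<le> (3 / 4) ^ card ?I * 2 ^ n"
    by (simp add: power_divide field_simps)
  also have "(3 / 4 :: real) ^ card ?I = miss_rate ^ (2 * card ?I)"
    by (simp add: power_mult miss_rate_def)
  also have "\<dots> \<le> miss_rate ^ (t + 1)"
    using card_even_blocks[OF d(1), of t] by (intro power_decreasing) (auto simp: miss_rate_def)
  finally show ?thesis by simp
qed

section \<open>The limit distribution\<close>

lemma sum_blists_add:
  fixes g :: "bool list \<Rightarrow> 'a::comm_monoid_add"
  shows "sum g (blists (a + b)) = (\<Sum>us\<in>blists a. \<Sum>vs\<in>blists b. g (us @ vs))"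
  by (induction a arbitrary: g) (simp_all add: sum_blists_Suc sum.distrib)

lemma sum_blists_rev:
  fixes g :: "bool list \<Rightarrow> 'a::comm_monoid_add"
  shows "(\<Sum>us\<in>blists a. g (rev us)) = sum g (blists a)"
  by (rule sum.reindex_bij_witness[of _ rev rev]) (auto simp: blists_def)

definition miss_dist :: "nat \<Rightarrow> nat \<Rightarrow> real" where
  "miss_dist m k = ext_avg m (\<lambda>as bs. of_bool (misses m as bs = k)) [] []"

lemma real_card_blists: "real (card {xs \<in> blists n. Q xs}) = (\<Sum>xs\<in>blists n. of_bool (Q xs))"
proof -
  have "{xs \<in> blists n. Q xs} = blists n \<inter> {xs. Q xs}" by auto
  then show ?thesis by simp
qed

text \<open>For 2m \<le> n the first m bits of \<open>xs\<close> and of \<open>rev xs\<close> come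
  from disjoint ends, and the bits in between only contribute a power of 2. Hence equality, without
  an error term.\<close>

lemma miss_dist_eq_card:
  assumes "2 * m \<le> n"
  shows "real (card {xs \<in> blists n. misses m xs (rev xs) = k}) / 2 ^ n = miss_dist m k"
proof -
  obtain l where n: "n = m + (l + m)"
    using assms by (metis add.assoc add.commute le_Suc_ex mult_2)
  have "(\<Sum>xs\<in>blists n. of_bool (misses m xs (rev xs) = k)) =
      (\<Sum>us\<in>blists m. \<Sum>vs\<in>blists l. \<Sum>ws\<in>blists m. of_bool (misses m (us @ vs @ ws) (rev (us @ vs @ ws)) = k))"
    unfolding n sum_blists_add ..
  also have "\<dots> = (\<Sum>us\<in>blists m. \<Sum>vs\<in>blists l. \<Sum>ws\<in>blists m. of_bool (misses m us (rev ws) = k))"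
    by (intro sum.cong refl) (simp add: misses_append length_blists)
  also have "\<dots> = (\<Sum>us\<in>blists m. \<Sum>vs\<in>blists l. \<Sum>ws\<in>blists m. of_bool (misses m us ws = k))"
    by (intro sum.cong refl sum_blists_rev)
  also have "\<dots> = 2 ^ l * (\<Sum>us\<in>blists m. \<Sum>ws\<in>blists m. (of_bool (misses m us ws = k) :: real))"
    by (simp add: sum_distrib_left)
  finally have "real (card {xs \<in> blists n. misses m xs (rev xs) = k}) =
      2 ^ l * (\<Sum>us\<in>blists m. \<Sum>ws\<in>blists m. (of_bool (misses m us ws = k) :: real))"
    by (simp only: real_card_blists)
  moreover have "(2::real) ^ n = 2 ^ l * 4 ^ m"
  proof -
    have "(2::real) ^ m * 2 ^ m = 4 ^ m"
      by (simp flip: power_mult_distrib)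
    then show ?thesis by (simp add: n power_add)
  qed
  ultimately show ?thesis
    by (simp add: miss_dist_def ext_avg_def)
qed

text \<open>The sum of \<open>miss_rate ^ (t + 1)\<close> over t \<ge> m: a union bound for any miss
  from m on.\<close>

definition tail_error :: "nat \<Rightarrow> real" where
  "tail_error m = miss_rate ^ (m + 1) / (1 - miss_rate)"

lemma miss_rate_bounds: "0 < miss_rate" "miss_rate < 1"
  by (auto simp: miss_rate_def real_less_lsqrt)

lemma tail_error_tendsto_0: "tail_error \<longlonglongrightarrow> 0"
proof -
  have "(\<lambda>m. miss_rate ^ m * (miss_rate / (1 - miss_rate))) \<longlonglongrightarrow> 0 * (miss_rate / (1 - miss_rate))"
    using miss_rate_bounds by (intro tendsto_intros LIMSEQ_power_zero) auto
  then show ?thesis by (simp add: tail_error_def[abs_def] mult_ac)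
qed

lemma card_diff_le:
  assumes "finite X" "Y \<subseteq> X" "Z \<subseteq> X" "W \<subseteq> X" "\<And>x. x \<in> X \<Longrightarrow> x \<notin> W \<Longrightarrow> x \<in> Y \<longleftrightarrow> x \<in> Z"
  shows "\<bar>real (card Y) - real (card Z)\<bar> \<le> real (card W)"
proof -
  have fin: "finite Y" "finite Z" "finite W"
    using assms finite_subset by blast+
  have "card Y \<le> card (Z \<union> W)" "card Z \<le> card (Y \<union> W)"
    using assms fin by (intro card_mono; blast)+
  then show ?thesis
    using card_Un_le[of Z W] card_Un_le[of Y W] by linarith
qed

lemma P_missing_approx:
  assumes "2 * m + 2 \<le> n"
  shows "\<bar>P_missing n (2 * k) - miss_dist m k\<bar> \<le> tail_error m"
proof -
  let ?B = "\<lambda>t. {xs \<in> blists n. \<not> hit xs (rev xs) t}"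
  let ?W = "\<Union>t\<in>{m..<n - 1}. ?B t"
  let ?Y = "{xs \<in> blists n. True \<in> set xs \<and> misses n xs (rev xs) = k}"
  let ?Z = "{xs \<in> blists n. misses m xs (rev xs) = k}"
  have "\<bar>real (card ?Y) - real (card ?Z)\<bar> \<le> real (card ?W)"
  proof (rule card_diff_le[OF finite_blists[of n]])
    fix xs assume xs: "xs \<in> blists n" "xs \<notin> ?W"
    then have len: "length xs = n" and hits: "\<And>t. m \<le> t \<Longrightarrow> t < n - 1 \<Longrightarrow> hit xs (rev xs) t"
      by (auto simp: blists_def)
    have "m < n - 1" using assms by simp
    with hits[of m] obtain i where "bit_at xs i"
      by (auto simp: hit_def)
    then have true: "True \<in> set xs" and i: "i < n" "xs ! i"
      using len by (auto simp: bit_at_def in_set_conv_nth)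
    \<comment> \<open>The difference 0 lies outside the union bound; it is present because the hit
      at m shows that S is nonempty.\<close>
    have "hit xs (rev xs) (n - 1)"
      using i assms by (subst hit_rev[OF len]) (auto intro!: exI[of _ i])
    with hits have "hit xs (rev xs) t" if "m \<le> t" "t < n" for t
      using that by (cases "t = n - 1") auto
    then have "{j. m \<le> j \<and> j < m + (n - m) \<and> \<not> hit xs (rev xs) j} = {}"
      using assms by auto
    then have "misses n xs (rev xs) = misses m xs (rev xs)"
      using misses_split[of m "n - m" xs "rev xs"] assms by (simp only: card.empty) simp
    with xs true show "xs \<in> ?Y \<longleftrightarrow> xs \<in> ?Z" by auto
  qed auto
  also have "real (card ?W) \<le> real (\<Sum>t\<in>{m..<n - 1}. card (?B t))"
    by (intro of_nat_mono card_UN_le) simp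
  also have "\<dots> \<le> (\<Sum>t\<in>{m..<n - 1}. miss_rate ^ (t + 1) * 2 ^ n)"
    unfolding of_nat_sum by (intro sum_mono card_not_hit_rev_le) simp
  also have "\<dots> = (\<Sum>t\<in>{m..<n - 1}. miss_rate ^ (t + 1)) * 2 ^ n"
    by (simp add: sum_distrib_right)
  also have "\<dots> \<le> tail_error m * 2 ^ n"
  proof (rule mult_right_mono)
    have "(\<Sum>t\<in>{m..<n - 1}. miss_rate ^ (t + 1)) = (\<Sum>i<n - 1 - m. miss_rate ^ (m + 1) * miss_rate ^ i)"
      by (rule sum.reindex_bij_witness[of _ "\<lambda>i. m + i" "\<lambda>t. t - m"]) (auto simp flip: power_add)
    also have "\<dots> = miss_rate ^ (m + 1) * (\<Sum>i<n - 1 - m. miss_rate ^ i)"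
      by (simp add: sum_distrib_left)
    also have "(\<Sum>i<n - 1 - m. miss_rate ^ i) = (1 - miss_rate ^ (n - 1 - m)) / (1 - miss_rate)"
      using miss_rate_bounds by (subst sum_gp_strict) auto
    also have "miss_rate ^ (m + 1) * \<dots> \<le> miss_rate ^ (m + 1) * (1 / (1 - miss_rate))"
      using miss_rate_bounds by (intro mult_left_mono divide_right_mono) auto
    finally show "(\<Sum>t\<in>{m..<n - 1}. miss_rate ^ (t + 1)) \<le> tail_error m"
      by (simp add: tail_error_def)
  qed simp
  finally have "\<bar>real (card ?Y) - real (card ?Z)\<bar> / 2 ^ n \<le> tail_error m"
    by (simp add: field_simps)
  moreover have "P_missing n (2 * k) - miss_dist m k = (real (card ?Y) - real (card ?Z)) / 2 ^ n"
    using assms by (subst miss_dist_eq_card[symmetric, of m n]) (auto simp: P_missing_even diff_divide_distrib)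
  ultimately show ?thesis by simp
qed

text \<open>The error bound does not depend on n, so all late terms lie close to the same
  \<open>miss_dist m k\<close>.\<close>

lemma convergent_P_missing_even: "convergent (\<lambda>n. P_missing n (2 * k))"
proof (rule Cauchy_convergent, rule metric_CauchyI)
  fix e :: real assume "e > 0"
  then have "\<forall>\<^sub>F m in sequentially. tail_error m < e / 2"
    using order_tendstoD(2)[OF tail_error_tendsto_0, of "e / 2"] by simp
  then obtain m where m: "tail_error m < e / 2"
    by (auto simp: eventually_sequentially)
  have "dist (P_missing n (2 * k)) (P_missing n' (2 * k)) < e" if "n \<ge> 2 * m + 2" "n' \<ge> 2 * m + 2" for n n'
    using P_missing_approx[OF that(1), of k] P_missing_approx[OF that(2), of k] m
    unfolding dist_real_def by linarith
  then show "\<exists>M. \<forall>n\<ge>M. \<forall>n'\<ge>M. dist (P_missing n (2 * k)) (P_missing n' (2 * k)) < e"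
    by blast
qed

lemma P_missing_even_tendsto: "(\<lambda>n. P_missing n (2 * k)) \<longlonglongrightarrow> ell (2 * k)"
  unfolding ell_def using convergent_P_missing_even by (simp add: convergent_LIMSEQ_iff)

lemma P_missing_odd_tendsto: 
  assumes "odd k"
  shows "(\<lambda>n. P_missing n k) \<longlonglongrightarrow> 0"
proof (rule tendsto_sandwich)
  show "\<forall>\<^sub>F n in sequentially. 0 \<le> P_missing n k"
    by (simp add: P_missing_def)
  show "\<forall>\<^sub>F n in sequentially. P_missing n k \<le> (1 / 2) ^ n"
    using P_missing_odd[OF assms] by (simp add: power_one_over)
  show "(\<lambda>n. (1 / 2 :: real) ^ n) \<longlonglongrightarrow> 0"
    by (intro LIMSEQ_power_zero) simp
qed simp

lemma miss_dist_tendsto: "(\<lambda>m. miss_dist m k) \<longlonglongrightarrow> ell (2 * k)"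
proof -
  have "norm (miss_dist m k - ell (2 * k)) \<le> tail_error m" for m
  proof -
    have "(\<lambda>n. \<bar>P_missing n (2 * k) - miss_dist m k\<bar>) \<longlonglongrightarrow> \<bar>ell (2 * k) - miss_dist m k\<bar>"
      by (intro tendsto_intros P_missing_even_tendsto)
    then have "\<bar>ell (2 * k) - miss_dist m k\<bar> \<le> tail_error m"
      by (rule LIMSEQ_le_const2) (use P_missing_approx in blast)
    then show ?thesis by (simp add: abs_minus_commute)
  qed
  then have "(\<lambda>m. miss_dist m k - ell (2 * k)) \<longlonglongrightarrow> 0"
    by (intro Lim_null_comparison[OF _ tail_error_tendsto_0] always_eventually) blast
  then show ?thesis by (rule LIM_zero_cancel)
qed

section \<open>Conditioning on zero lying in one or both sets\<close>

definition shifted :: "(nat \<Rightarrow> real) \<Rightarrow> nat \<Rightarrow> real" where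
  "shifted g k = (if k = 0 then 0 else g (k - 1))"

text \<open>Conditioned on 0 in Y only: there are 2^(m + 1) * 2^m = 2 * 4^m pairs of lists.\<close>

definition half_cond_dist :: "nat \<Rightarrow> nat \<Rightarrow> real" where
  "half_cond_dist m k =
    (\<Sum>xs\<in>blists (Suc m). \<Sum>ys\<in>blists m. of_bool (misses (Suc m) xs (True # ys) = k)) / (2 * 4 ^ m)"

definition cond_dist :: "nat \<Rightarrow> nat \<Rightarrow> real" where
  "cond_dist m k = ext_avg m (\<lambda>as bs. of_bool (misses (Suc m) as bs = k)) [True] [True]"

lemma misses_False_Cons: "misses (Suc m) xs (False # ys) = Suc (misses m xs ys)"
proof -
  have "hit xs (False # ys) (Suc j) = hit xs ys j" for j
  proof -
    have "bit_at (False # ys) (Suc j - i) = (i \<le> j \<and> bit_at ys (j - i))" if "i \<le> Suc j" for i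
      using that by (cases "i = Suc j") (auto simp: bit_at_def Suc_diff_le)
    then show ?thesis
      unfolding hit_def by (metis le_SucI)
  qed
  moreover have "\<not> hit xs (False # ys) 0"
    by (simp add: hit_def bit_at_def)
  ultimately have "j < Suc m \<and> \<not> hit xs (False # ys) j \<longleftrightarrow> j \<in> insert 0 (Suc ` {j. j < m \<and> \<not> hit xs ys j})" for j
    by (cases j) auto
  then have "{j. j < Suc m \<and> \<not> hit xs (False # ys) j} = insert 0 (Suc ` {j. j < m \<and> \<not> hit xs ys j})"
    by blast
  then show ?thesis
    by (simp add: misses_def card_image)
qed

lemma misses_commute: "misses m xs ys = misses m ys xs"
  by (simp add: misses_def hit_commute)

lemma misses_False_Cons_left: "misses (Suc m) (False # xs) ys = Suc (misses m xs ys)"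
  by (subst (1 2) misses_commute) (rule misses_False_Cons)

lemma sum_of_bool_Suc:
  "(\<Sum>xs\<in>X. \<Sum>ys\<in>Y. (of_bool (Suc (g xs ys) = k) :: real)) =
    shifted (\<lambda>k. \<Sum>xs\<in>X. \<Sum>ys\<in>Y. of_bool (g xs ys = k)) k"
  by (cases k) (simp_all add: shifted_def)

text \<open>Split on the first bit of \<open>ys\<close>. If it is False, one miss is added and only
  the first m bits of \<open>xs\<close> still matter, whence the factor 2 in the proof.\<close>

lemma miss_dist_Suc: "miss_dist (Suc m) k = half_cond_dist m k / 2 + shifted (miss_dist m) k / 2"
proof -
  let ?T = "\<lambda>k. \<Sum>xs\<in>blists m. \<Sum>ys\<in>blists m. (of_bool (misses m xs ys = k) :: real)"
  have drop: "misses m (xs @ [b]) ys = misses m xs ys" if "xs \<in> blists m" "ys \<in> blists m" for xs ys b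
    using that misses_append[of m xs ys "[b]" "[]"] by (simp add: length_blists)
  have "(\<Sum>xs\<in>blists (Suc m). \<Sum>ys\<in>blists m. (of_bool (Suc (misses m xs ys) = k) :: real)) =
      2 * (\<Sum>xs\<in>blists m. \<Sum>ys\<in>blists m. of_bool (Suc (misses m xs ys) = k))"
    by (subst sum_blists_Suc_snoc) (simp add: drop cong: sum.cong)
  also have "\<dots> = 2 * shifted ?T k"
    by (simp only: sum_of_bool_Suc)
  also have "shifted ?T k = 4 ^ m * shifted (miss_dist m) k"
    by (simp add: shifted_def miss_dist_def ext_avg_def)
  finally show ?thesis
    by (simp add: miss_dist_def ext_avg_def half_cond_dist_def sum_blists_Suc[where g = "\<lambda>ys. of_bool (misses (Suc m) xs ys = k)" for xs]
      misses_False_Cons sum.distrib add_divide_distrib)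
qed

lemma half_cond_dist_Suc:
  "half_cond_dist (Suc m) k = cond_dist (Suc m) k / 2 + shifted (half_cond_dist m) k / 2"
proof -
  let ?T = "\<lambda>k. \<Sum>xs\<in>blists (Suc m). \<Sum>ys\<in>blists m. (of_bool (misses (Suc m) xs (True # ys) = k) :: real)"
  have drop: "misses (Suc m) xs (True # ys @ [b]) = misses (Suc m) xs (True # ys)"
    if "xs \<in> blists (Suc m)" "ys \<in> blists m" for xs ys b
    using that misses_append[of "Suc m" xs "True # ys" "[]" "[b]"] by (simp add: length_blists)
  have "(\<Sum>xs\<in>blists (Suc m). \<Sum>ys\<in>blists (Suc m). (of_bool (Suc (misses (Suc m) xs (True # ys)) = k) :: real)) =
      2 * (\<Sum>xs\<in>blists (Suc m). \<Sum>ys\<in>blists m. of_bool (Suc (misses (Suc m) xs (True # ys)) = k))"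
    unfolding sum_blists_Suc_snoc[where g = "\<lambda>ys. of_bool (Suc (misses (Suc m) xs (True # ys)) = k)" for xs]
    by (simp add: drop sum_distrib_left cong: sum.cong)
  also have "\<dots> = 2 * shifted ?T k"
    by (simp only: sum_of_bool_Suc)
  also have "shifted ?T k = 2 * 4 ^ m * shifted (half_cond_dist m) k"
    by (simp add: shifted_def half_cond_dist_def)
  finally have *: "(\<Sum>xs\<in>blists (Suc m). \<Sum>ys\<in>blists (Suc m). (of_bool (Suc (misses (Suc m) xs (True # ys)) = k) :: real)) =
      4 ^ Suc m * shifted (half_cond_dist m) k" by simp
  have "half_cond_dist (Suc m) k = ((\<Sum>xs\<in>blists (Suc m). \<Sum>ys\<in>blists (Suc m). of_bool (misses (Suc (Suc m)) (True # xs) (True # ys) = k)) +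
      4 ^ Suc m * shifted (half_cond_dist m) k) / (2 * 4 ^ Suc m)"
    unfolding half_cond_dist_def sum_blists_Suc[of _ "Suc m"] misses_False_Cons_left * ..
  then show ?thesis
    by (simp add: cond_dist_def ext_avg_def add_divide_distrib)
qed

text \<open>\<open>miss_dist_Suc\<close> solved for the conditioned law, in the limit;
  \<open>cond_lim\<close> does the same with \<open>half_cond_dist_Suc\<close>.\<close>

definition half_cond_lim :: "nat \<Rightarrow> real" where
  "half_cond_lim k = 2 * ell (2 * k) - shifted (\<lambda>k. ell (2 * k)) k"

definition cond_lim :: "nat \<Rightarrow> real" where
  "cond_lim k = 2 * half_cond_lim k - shifted half_cond_lim k"

lemma tendsto_shifted:
  assumes "\<And>k. (\<lambda>m. g m k) \<longlonglongrightarrow> h k"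
  shows "(\<lambda>m. shifted (g m) k) \<longlonglongrightarrow> shifted h k"
  by (simp add: shifted_def assms)

lemma half_cond_dist_tendsto: "(\<lambda>m. half_cond_dist m k) \<longlonglongrightarrow> half_cond_lim k"
proof -
  have "half_cond_dist m k = 2 * miss_dist (Suc m) k - shifted (miss_dist m) k" for m
    by (simp add: miss_dist_Suc)
  then show ?thesis
    unfolding half_cond_lim_def
    by (simp only:) (intro tendsto_intros tendsto_shifted miss_dist_tendsto LIMSEQ_Suc)
qed

lemma cond_dist_tendsto: "(\<lambda>m. cond_dist m k) \<longlonglongrightarrow> cond_lim k"
proof (rule LIMSEQ_imp_Suc)
  have "cond_dist (Suc m) k = 2 * half_cond_dist (Suc m) k - shifted (half_cond_dist m) k" for m
    by (simp add: half_cond_dist_Suc)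
  then show "(\<lambda>m. cond_dist (Suc m) k) \<longlonglongrightarrow> cond_lim k"
    unfolding cond_lim_def
    by (simp only:) (intro tendsto_intros tendsto_shifted half_cond_dist_tendsto LIMSEQ_Suc)
qed

section \<open>Lower bounds and total mass\<close>

lemma ell_even_nonneg: "ell (2 * k) \<ge> 0"
  by (rule LIMSEQ_le_const[OF P_missing_even_tendsto]) (auto simp: P_missing_def)

text \<open>With probability 1 / 2 the set Y omits 0, which turns k misses of the shifted pair into
  k + 1.\<close>

lemma ell_even_halving: "ell (2 * k) \<le> 2 * ell (2 * Suc k)"
proof -
  have "half_cond_lim (Suc k) \<ge> 0"
    by (rule LIMSEQ_le_const[OF half_cond_dist_tendsto])
      (auto simp: half_cond_dist_def intro!: divide_nonneg_nonneg sum_nonneg)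
  then show ?thesis by (simp add: half_cond_lim_def shifted_def)
qed

lemma ext_avg_misses_le: "ext_avg m (\<lambda>as bs. real (misses m as bs)) [] [] \<le> 3"
proof -
  have "ext_avg m (\<lambda>as bs. real (misses (0 + m) as bs)) [] [] \<le> 0 + 1 * (\<Sum>j\<in>{0..<0 + m}. miss_prob [] [] j)"
    by (rule ext_avg_linear_bound) (auto simp: misses_def)
  also have "\<dots> \<le> 3"
    using sum_miss_prob_le_tail_weight[of "[]" 0 "[]" "[]" m] by simp
  finally show ?thesis by simp
qed

lemma sum_miss_dist: "(\<Sum>k<N. miss_dist m k) = ext_avg m (\<lambda>as bs. of_bool (misses m as bs < N)) [] []"
proof -
  have "(\<Sum>k<N. miss_dist m k) = ext_avg m (\<lambda>as bs. \<Sum>k<N. of_bool (misses m as bs = k)) [] []"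
    by (simp only: miss_dist_def ext_avg_sum)
  also have "(\<lambda>as bs. \<Sum>k<N. of_bool (misses m as bs = k) :: real) = (\<lambda>as bs. of_bool (misses m as bs < N))"
    by (intro ext) (simp add: of_bool_def sum.delta)
  finally show ?thesis .
qed

text \<open>The lower bound is Markov's inequality for a mean of at most 3. It is uniform in m, so
  no mass escapes in the limit.\<close>

lemma sum_ell_even_bounds:
  assumes "N > 0"
  shows "(\<Sum>k<N. ell (2 * k)) \<le> 1" "(\<Sum>k<N. ell (2 * k)) \<ge> 1 - 3 / real N"
proof -
  have lim: "(\<lambda>m. \<Sum>k<N. miss_dist m k) \<longlonglongrightarrow> (\<Sum>k<N. ell (2 * k))"
    by (intro tendsto_sum miss_dist_tendsto)
  have "(\<Sum>k<N. miss_dist m k) \<le> 1" for m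
    unfolding sum_miss_dist using ext_avg_mono[of m "\<lambda>as bs. of_bool (misses m as bs < N)" "[]" "[]" "\<lambda>_ _. 1"] by simp
  then show "(\<Sum>k<N. ell (2 * k)) \<le> 1"
    by (intro LIMSEQ_le_const2[OF lim]) blast
  have "1 - 3 / real N \<le> (\<Sum>k<N. miss_dist m k)" for m
  proof -
    have "1 - 3 / real N \<le> 1 + (- 1 / real N) * ext_avg m (\<lambda>as bs. real (misses m as bs)) [] []"
      using ext_avg_misses_le[of m] assms by (simp add: field_simps)
    also have "\<dots> = ext_avg m (\<lambda>as bs. 1 + (- 1 / real N) * real (misses m as bs)) [] []"
      by (simp only: ext_avg_add ext_avg_cmult ext_avg_const)
    also have "\<dots> \<le> ext_avg m (\<lambda>as bs. of_bool (misses m as bs < N)) [] []"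
      using assms by (intro ext_avg_mono) (auto simp: field_simps of_bool_def)
    finally show ?thesis unfolding sum_miss_dist .
  qed
  then show "(\<Sum>k<N. ell (2 * k)) \<ge> 1 - 3 / real N"
    by (intro LIMSEQ_le_const[OF lim]) blast
qed

lemma ell_odd: "odd k \<Longrightarrow> ell k = 0"
  unfolding ell_def using P_missing_odd_tendsto limI by blast

lemma ell_sums: "ell sums 1"
proof -
  have "(\<lambda>N. \<Sum>k<N. ell (2 * k)) \<longlonglongrightarrow> 1"
  proof (rule tendsto_sandwich)
    show "\<forall>\<^sub>F N in sequentially. 1 - 3 / real N \<le> (\<Sum>k<N. ell (2 * k))"
      using eventually_gt_at_top[of 0] by eventually_elim (rule sum_ell_even_bounds)
    show "\<forall>\<^sub>F N in sequentially. (\<Sum>k<N. ell (2 * k)) \<le> 1"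
      using eventually_gt_at_top[of 0] by eventually_elim (rule sum_ell_even_bounds)
    show "(\<lambda>N. 1 - 3 / real N) \<longlonglongrightarrow> 1"
      using tendsto_diff[OF tendsto_const[of 1] lim_const_over_n[of 3]] by simp
  qed simp
  then have "(\<lambda>k. ell (2 * k)) sums 1"
    by (simp add: sums_def)
  moreover have "strict_mono (\<lambda>k::nat. 2 * k)"
    by (simp add: strict_mono_def)
  moreover have "ell n = 0" if "n \<notin> range (\<lambda>k::nat. 2 * k)" for n
    using that by (intro ell_odd) (auto elim!: evenE)
  ultimately show ?thesis
    by (subst (asm) sums_mono_reindex) auto
qed

section \<open>Linear functionals of the conditioned law\<close>

definition functional :: "real \<Rightarrow> real list \<Rightarrow> nat \<Rightarrow> real" where
  "functional c cs k = c + (if k < length cs then cs ! k else 0)"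

lemma functional_eq_sum: "functional c cs k = c + (\<Sum>i<length cs. cs ! i * of_bool (k = i))"
  by (simp add: functional_def of_bool_def sum.delta if_distrib cong: if_cong)

lemma tree_avg_functional:
  "tree_avg (functional c cs) [True] [True] d = c + (\<Sum>i<length cs. cs ! i * cond_dist d i)"
proof -
  have "tree_avg (functional c cs) [True] [True] d =
      ext_avg d (\<lambda>as bs. c + (\<Sum>i<length cs. cs ! i * of_bool (misses (Suc d) as bs = i))) [True] [True]"
    by (simp add: tree_avg_def functional_eq_sum)
  also have "\<dots> = c + (\<Sum>i<length cs. cs ! i * cond_dist d i)"
    by (simp only: ext_avg_add ext_avg_sum ext_avg_cmult ext_avg_const cond_dist_def)
  finally show ?thesis .
qed

text \<open>At the root position 0 is hit and position 1 is open, which gives 0 misses and one False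
  flag. The tree bound is a fixed number, so it passes to the limit; subtracting the shift c leaves
  the sign.\<close>

lemma cond_lim_functional_neg:
  assumes valid: "valid_rules c (functional (numeral c) cs) 0 rs"
    and eval: "eval_tree n c rs s [False] [True] [True] < s * c"
  shows "(\<Sum>i<length cs. cs ! i * cond_lim i) < 0"
proof -
  have "future_hits [False] [True] [True]"
    by (auto simp: future_hits_def hit_def bit_at_def)
  moreover have "misses (length [True]) [True] [True] = 0"
    by (auto simp: misses_def hit_def bit_at_def)
  ultimately have "\<forall>\<^sub>F d in sequentially. numeral s * tree_avg (functional (numeral c) cs) [True] [True] d \<le>
      numeral (eval_tree n c rs s [False] [True] [True])"
    using sound_eval_tree[of c "functional (numeral c) cs" n] valid unfolding sound_evaluator_def
    by (metis (full_types))
  moreover have "(\<lambda>d. numeral s * tree_avg (functional (numeral c) cs) [True] [True] d) \<longlonglongrightarrow>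
      numeral s * (numeral c + (\<Sum>i<length cs. cs ! i * cond_lim i))"
    unfolding tree_avg_functional by (intro tendsto_intros cond_dist_tendsto)
  ultimately have "numeral s * (numeral c + (\<Sum>i<length cs. cs ! i * cond_lim i)) \<le>
      (numeral (eval_tree n c rs s [False] [True] [True]) :: real)"
    by (intro tendsto_upperbound[OF _ _ sequentially_bot])
  also have "\<dots> < numeral (s * c)"
    using eval by (simp only: numeral_less_iff)
  also have "numeral (s * c) = (numeral s :: real) * numeral c"
    by (rule numeral_mult)
  finally have "(numeral s :: real) * (\<Sum>i<length cs. cs ! i * cond_lim i) < 0"
    by (simp only: distrib_left)
  then show ?thesis
    by (simp add: mult_less_0_iff)
qed

section \<open>Evaluation of the tree bounds\<close>

lemma eval_tree_numeral: "eval_tree (numeral v) c = eval_node c (eval_tree (pred_numeral v) c)"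
  by (simp add: numeral_eq_Suc)

lemmas eval_simps = eval_tree_numeral eval_tree.simps pred_numeral_simps Num.BitM.simps
  eval_node.simps test_node.simps decide_node.simps split_node.simps child.simps stop_node.simps
  leaf_bound.simps cutoff.simps no_miss_bound.simps add_half.simps tail_bound.simps halve.simps
  or_list.simps append.simps num_of_nat_numeral_eq add_num_simps mult_num_simps le_num_simps less_num_simps

text \<open>The constant added to the coefficients makes the functional positive, as \<open>num\<close> requires. The
  cutoffs were tuned numerically so that a tree of moderate size still decides the sign; the first
  and the fourth tree are large (about 10^5 and 3 * 10^4 nodes) because those margins are small.\<close>

lemma cond_lim_ineq_2_4: "cond_lim 0 < 4 * cond_lim 2"
proof -
  \<comment> \<open>The functional takes the values 6, 5, 1 and then 5. Each rule is exact at t = 0: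
    \<open>Unless_Miss\<close> where all later values are lower, \<open>Const\<close> where none is
    higher, \<open>Linear\<close> where they rise.\<close>
  let ?rs = "[Unless_Miss (num_of_nat 600) (num_of_nat 5) num.One,
      Const (num_of_nat 600) (num_of_nat 5),
      Linear (num_of_nat 600) num.One (num_of_nat 4)]"
  have valid: "valid_rules (num_of_nat 5) (functional (numeral (num_of_nat 5)) [1, 0, -4]) 0 ?rs"
    by (auto simp: functional_def nth_Cons' num_of_nat_numeral_eq)
  \<comment> \<open>The root mass is 2^29: twelve quarterings still leave 2^5 for exact
    halvings.\<close>
  have eval: "eval_tree 12 (num_of_nat 5) ?rs (num_of_nat 536870912) [False] [True] [True] < (num_of_nat 536870912) * (num_of_nat 5)"
    by (simp only: eval_simps)
  show ?thesis
    using cond_lim_functional_neg[OF valid eval] by (simp add: numeral_eq_Suc lessThan_Suc)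
qed

lemma cond_lim_ineq_6_2: "4 * cond_lim 2 + 4 * cond_lim 3 < 2 * cond_lim 0 + cond_lim 1"
proof -
  let ?rs = "[Linear (num_of_nat 1024) num.One (num_of_nat 3),
      Linear (num_of_nat 1024) (num_of_nat 2) (num_of_nat 5),
      Const (num_of_nat 1024) (num_of_nat 7),
      Const (num_of_nat 1024) (num_of_nat 7)]"
  have valid: "valid_rules (num_of_nat 3) (functional (numeral (num_of_nat 3)) [-2, -1, 4, 4]) 0 ?rs"
    by (auto simp: functional_def nth_Cons' num_of_nat_numeral_eq)
  have eval: "eval_tree 12 (num_of_nat 3) ?rs (num_of_nat 1048576) [False] [True] [True] < (num_of_nat 1048576) * (num_of_nat 3)"
    by (simp only: eval_simps)
  show ?thesis
    using cond_lim_functional_neg[OF valid eval] by (simp add: numeral_eq_Suc lessThan_Suc)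
qed

lemma cond_lim_ineq_0_6: "2 * cond_lim 0 < 3 * cond_lim 1 + 4 * cond_lim 2 + 4 * cond_lim 3"
proof -
  let ?rs = "[Unless_Miss (num_of_nat 4096) (num_of_nat 5) (num_of_nat 2),
      Linear (num_of_nat 4096) (num_of_nat 2) num.One,
      Linear (num_of_nat 4096) num.One (num_of_nat 2),
      Linear (num_of_nat 4096) num.One (num_of_nat 4)]"
  have valid: "valid_rules (num_of_nat 5) (functional (numeral (num_of_nat 5)) [2, -3, -4, -4]) 0 ?rs"
    by (auto simp: functional_def nth_Cons' num_of_nat_numeral_eq)
  have eval: "eval_tree 12 (num_of_nat 5) ?rs (num_of_nat 1048576) [False] [True] [True] < (num_of_nat 1048576) * (num_of_nat 5)"
    by (simp only: eval_simps)
  show ?thesis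
    using cond_lim_functional_neg[OF valid eval] by (simp add: numeral_eq_Suc lessThan_Suc)
qed

lemma cond_lim_ineq_8_0: "8 * cond_lim 1 + 12 * cond_lim 2 + 16 * cond_lim 3 + 16 * cond_lim 4 < 11 * cond_lim 0"
proof -
  let ?rs = "[Linear (num_of_nat 2048) num.One (num_of_nat 19),
      Linear (num_of_nat 4096) (num_of_nat 20) (num_of_nat 4),
      Linear (num_of_nat 4096) (num_of_nat 24) (num_of_nat 4),
      Const (num_of_nat 2048) (num_of_nat 28),
      Unless_Miss (num_of_nat 2048) (num_of_nat 12) (num_of_nat 16)]"
  have valid: "valid_rules (num_of_nat 12) (functional (numeral (num_of_nat 12)) [-11, 8, 12, 16, 16]) 0 ?rs"
    by (auto simp: functional_def nth_Cons' num_of_nat_numeral_eq)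
  have eval: "eval_tree 12 (num_of_nat 12) ?rs (num_of_nat 268435456) [False] [True] [True] < (num_of_nat 268435456) * (num_of_nat 12)"
    by (simp only: eval_simps)
  show ?thesis
    using cond_lim_functional_neg[OF valid eval] by (simp add: numeral_eq_Suc lessThan_Suc)
qed

lemma cond_lim_ineq_10_8: "16 * cond_lim 5 < 2 * cond_lim 0 + 3 * cond_lim 1 + 4 * cond_lim 2 + 4 * cond_lim 3"
proof -
  \<comment> \<open>The values are 3, 2, 1, 1, 5, 21 and then 5. For k < 5 the slope is the least
    integer for which the line from the value at k reaches the peak 21 at 5 misses.\<close>
  let ?rs = "[Linear (num_of_nat 4096) (num_of_nat 3) (num_of_nat 4),
      Linear (num_of_nat 4096) (num_of_nat 2) (num_of_nat 5),
      Linear (num_of_nat 4096) num.One (num_of_nat 7),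
      Linear (num_of_nat 4096) num.One (num_of_nat 10),
      Linear (num_of_nat 4096) (num_of_nat 5) (num_of_nat 16),
      Unless_Miss (num_of_nat 4096) (num_of_nat 5) (num_of_nat 16)]"
  have valid: "valid_rules (num_of_nat 5) (functional (numeral (num_of_nat 5)) [-2, -3, -4, -4, 0, 16]) 0 ?rs"
    by (auto simp: functional_def nth_Cons' num_of_nat_numeral_eq)
  have eval: "eval_tree 12 (num_of_nat 5) ?rs (num_of_nat 1048576) [False] [True] [True] < (num_of_nat 1048576) * (num_of_nat 5)"
    by (simp only: eval_simps)
  show ?thesis
    using cond_lim_functional_neg[OF valid eval] by (simp add: numeral_eq_Suc lessThan_Suc)
qed

text \<open>Under these equations the two sides of each of the five inequalities differ by 16 or 64
  times a difference of two values of \<open>ell\<close>.\<close>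

lemma cond_lim_eqs:
  "cond_lim 0 = 4 * ell 0"
  "cond_lim 1 = 4 * ell 2 - 4 * ell 0"
  "cond_lim 2 = 4 * ell 4 - 4 * ell 2 + ell 0"
  "cond_lim 3 = 4 * ell 6 - 4 * ell 4 + ell 2"
  "cond_lim 4 = 4 * ell 8 - 4 * ell 6 + ell 4"
  "cond_lim 5 = 4 * ell 10 - 4 * ell 8 + ell 6"
  by (simp_all add: cond_lim_def half_cond_lim_def shifted_def)

lemma ell_order:
  "ell 10 < ell 8" "ell 8 < ell 0" "ell 0 < ell 6" "ell 6 < ell 2" "ell 2 < ell 4"
  using cond_lim_ineq_2_4 cond_lim_ineq_6_2 cond_lim_ineq_0_6 cond_lim_ineq_8_0 cond_lim_ineq_10_8
  unfolding cond_lim_eqs by (simp_all add: algebra_simps)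

text \<open>Positivity starts from \<open>ell 8 < ell 0\<close> with \<open>ell 8\<close>
  nonnegative, and \<open>ell_even_halving\<close> carries it upward.\<close>

lemma ell_even_pos: "ell (2 * k) > 0"
proof (induction k)
  case 0
  then show ?case using ell_even_nonneg[of 4] ell_order(2) by simp
next
  case (Suc k)
  then show ?case using ell_even_halving[of k] by simp
qed

theorem theorem1p3:
  "(\<forall>k. convergent (\<lambda>n. P_missing n k)) \<and>
   (\<forall>k. ell k > 0 \<longleftrightarrow> even k) \<and>
   ell sums 1 \<and>
   ell 10 < ell 8 \<and> ell 8 < ell 0 \<and> ell 0 < ell 6 \<and> ell 6 < ell 2 \<and> ell 2 < ell 4"
proof (intro conjI allI ell_sums ell_order)
  fix k
  show "convergent (\<lambda>n. P_missing n k)"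
    using convergent_P_missing_even convergentI[OF P_missing_odd_tendsto]
    by (cases "even k") (auto elim!: evenE)
  show "ell k > 0 \<longleftrightarrow> even k"
    using ell_even_pos by (cases "even k") (auto elim!: evenE simp: ell_odd)
qed

end
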